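(* Let $M$ be a regular irreducible algebraic submonoid of $M_n(\mathbb{C})$ and let $a\in M$. Then the Green class $D_a^M$ of $a$ in $M$ is a submanifold of $M_n(\mathbb{C})$.
   Context: $M_n(\mathbb{C})$ is the multiplicative monoid of $n\times n$ complex matrices, identified with $\mathbb{C}^{n^2}$. An algebraic submonoid $M$ of $M_n(\mathbb{C})$ is a submonoid (containing the identity matrix) that is the zero set of a collection of polynomials in the $n^2$ matrix entries; it is irreducible if it is not the union of two proper algebraic subsets, and regular if for every $a\in M$ there is $x\in M$ with $axa=a$. Green's relations in $M$: $a\,\mathscr L^M\, b$ iff $Ma=Mb$; $a\,\mathscr R^M\, b$ iff $aM=bM$; $\mathscr D^M=\mathscr L^M\circ\mathscr R^M$ is the smallest equivalence relation containing both; $D_a^M$ is the $\mathscr D^M$-class of $a$. All topological terms refer to the euclidean topology; manifolds are complex analytic, and a submanifold is an embedded one (carrying the subspace topology). *)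

theory Defs
  imports "HOL-Analysis.Analysis"
begin

text \<open>Matrices are \<open>complex ^ 'n ^ 'n\<close>, with product \<open>**\<close>, identity \<open>mat 1\<close>, and the
  euclidean norm of \<open>\<complex>\<close>-entries as topology.\<close>

subsection \<open>Algebraic subsets\<close>

text \<open>Polynomials in the matrix entries enter only through their values, so they are represented
  by polynomial functions, i.e. the ring of functions generated by constants and entries.\<close>

inductive matrix_polynomial :: "(complex ^ 'n ^ 'n \<Rightarrow> complex) \<Rightarrow> bool" where
  const: "matrix_polynomial (\<lambda>A. c)"
| entry: "matrix_polynomial (\<lambda>A. A $ i $ j)"
| add: "matrix_polynomial p \<Longrightarrow> matrix_polynomial q \<Longrightarrow> matrix_polynomial (\<lambda>A. p A + q A)"
| mult: "matrix_polynomial p \<Longrightarrow> matrix_polynomial q \<Longrightarrow> matrix_polynomial (\<lambda>A. p A * q A)"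

definition algebraic_set :: "(complex ^ 'n ^ 'n) set \<Rightarrow> bool" where
  "algebraic_set X \<longleftrightarrow> (\<exists>P. (\<forall>p\<in>P. matrix_polynomial p) \<and> X = {A. \<forall>p\<in>P. p A = 0})"

definition irreducible_set :: "(complex ^ 'n ^ 'n) set \<Rightarrow> bool" where
  "irreducible_set X \<longleftrightarrow>
     \<not> (\<exists>Y Z. algebraic_set Y \<and> algebraic_set Z \<and> Y \<subset> X \<and> Z \<subset> X \<and> X = Y \<union> Z)"

subsection \<open>Matrix monoids and Green's relations\<close>

definition matrix_submonoid :: "(complex ^ 'n ^ 'n) set \<Rightarrow> bool" where
  "matrix_submonoid M \<longleftrightarrow> mat 1 \<in> M \<and> (\<forall>a\<in>M. \<forall>b\<in>M. a ** b \<in> M)"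

definition algebraic_submonoid :: "(complex ^ 'n ^ 'n) set \<Rightarrow> bool" where
  "algebraic_submonoid M \<longleftrightarrow> matrix_submonoid M \<and> algebraic_set M"

definition regular_monoid :: "(complex ^ 'n ^ 'n) set \<Rightarrow> bool" where
  "regular_monoid M \<longleftrightarrow> (\<forall>a\<in>M. \<exists>x\<in>M. a ** x ** a = a)"

definition green_L :: "(complex ^ 'n ^ 'n) set \<Rightarrow> (complex ^ 'n ^ 'n) rel" where
  "green_L M = {(a, b). a \<in> M \<and> b \<in> M \<and> (\<lambda>x. x ** a) ` M = (\<lambda>x. x ** b) ` M}"

definition green_R :: "(complex ^ 'n ^ 'n) set \<Rightarrow> (complex ^ 'n ^ 'n) rel" where
  "green_R M = {(a, b). a \<in> M \<and> b \<in> M \<and> (\<lambda>x. a ** x) ` M = (\<lambda>x. b ** x) ` M}"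

definition green_D :: "(complex ^ 'n ^ 'n) set \<Rightarrow> (complex ^ 'n ^ 'n) rel" where
  "green_D M = green_L M O green_R M"

definition D_class :: "(complex ^ 'n ^ 'n) set \<Rightarrow> complex ^ 'n ^ 'n \<Rightarrow> (complex ^ 'n ^ 'n) set" where
  "D_class M a = green_D M `` {a}"

subsection \<open>Complex analytic submanifolds\<close>

text \<open>On \<open>complex ^ 'n ^ 'n\<close> the library's \<open>*s\<close> scales by a row vector, not by a complex number.\<close>

definition cscale :: "complex \<Rightarrow> complex ^ 'n ^ 'n \<Rightarrow> complex ^ 'n ^ 'n" where
  "cscale c A = (\<chi> i j. c * A $ i $ j)"

text \<open>Holomorphy in several variables: the (a priori real-linear) Frechet derivative exists and is
  \<open>\<complex>\<close>-linear at every point. Meant for open \<open>U\<close>.\<close>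

definition matrix_holomorphic_on ::
    "(complex ^ 'n ^ 'n \<Rightarrow> complex ^ 'n ^ 'n) \<Rightarrow> (complex ^ 'n ^ 'n) set \<Rightarrow> bool" where
  "matrix_holomorphic_on f U \<longleftrightarrow>
     (\<forall>x\<in>U. \<exists>f'. (f has_derivative f') (at x) \<and> (\<forall>c h. f' (cscale c h) = cscale c (f' h)))"

definition coordinate_subspace :: "('n \<times> 'n) set \<Rightarrow> (complex ^ 'n ^ 'n) set" where
  "coordinate_subspace I = {A. \<forall>i j. (i, j) \<notin> I \<longrightarrow> A $ i $ j = 0}"

text \<open>Embedded submanifolds of complex dimension \<open>k\<close>, by slice charts of the ambient space: near
  each point of \<open>S\<close>, a biholomorphic map \<open>\<phi> : U \<rightarrow> V\<close> between open sets
  straightens \<open>S\<close> to a \<open>k\<close>-dimensional coordinate subspace. The dimension is the same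
  at all points.\<close>

definition complex_submanifold_dim :: "nat \<Rightarrow> (complex ^ 'n ^ 'n) set \<Rightarrow> bool" where
  "complex_submanifold_dim k S \<longleftrightarrow>
     (\<forall>p\<in>S. \<exists>U V \<phi> \<psi> I.
        open U \<and> p \<in> U \<and> open V \<and> homeomorphism U V \<phi> \<psi> \<and>
        matrix_holomorphic_on \<phi> U \<and> matrix_holomorphic_on \<psi> V \<and>
        card I = k \<and> \<phi> ` (U \<inter> S) = V \<inter> coordinate_subspace I)"

definition complex_submanifold :: "(complex ^ 'n ^ 'n) set \<Rightarrow> bool" where
  "complex_submanifold S \<longleftrightarrow> (\<exists>k. complex_submanifold_dim k S)"

end

theory Submission
  imports Defs "HOL-Complex_Analysis.Cauchy_Integral_Formula" "HOL-Library.Function_Algebras"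
    "HOL-Computational_Algebra.Fundamental_Theorem_Algebra"
begin

text \<open>Let \<open>G = M \<inter> GL\<^sub>n\<close>. Elements of \<open>G\<close> have their inverses in \<open>M\<close>
(\<open>units_closed_under_inverse\<close>), so \<open>G\<close> is the group of units of \<open>M\<close>. The \<open>\<D>\<close>-class of \<open>a\<close> is a
submanifold because it is homogeneous under \<open>G \<times> G\<close> and because a locally algebraic set is smooth
somewhere. Three facts carry the argument.

Homogeneity: \<open>D\<^sub>a = G a G\<close> (\<open>D_class_eq_double_orbit\<close>). Suppose \<open>aM = bM = Y\<close>. The polynomial map
\<open>x \<mapsto> a x\<close> sends \<open>M\<close> onto \<open>Y\<close>, and by Chevalley's theorem the image \<open>aG\<close> of the Zariski-dense open
subset \<open>G\<close> contains \<open>{y \<in> Y. p y \<noteq> 0}\<close> for some polynomial \<open>p\<close> that does not vanish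
identically on \<open>Y\<close>; likewise \<open>bG\<close> contains \<open>{y \<in> Y. q y \<noteq> 0}\<close>. Irreducibility of \<open>M\<close> makes
\<open>p q\<close> nonzero somewhere on \<open>Y\<close>, so \<open>aG\<close> and \<open>bG\<close> meet and \<open>b \<in> aG\<close>. The form of Chevalley's
theorem used here (\<open>fibre_meets_nonvanishing_locus\<close>) follows from the algebraic fact that
homomorphisms into \<open>\<complex>\<close> extend generically along finitely generated extensions of domains
(\<open>hom_extension_finitely_generated\<close>).

Local algebraicity: near \<open>p\<close>, the class \<open>D\<^sub>p\<close> coincides with an algebraic set
(\<open>D_class_locally_algebraic\<close>). In a regular monoid the Green relations are detected by row and column
spaces, so near \<open>p\<close> the class consists of the elements of \<open>M\<close> of the same rank as \<open>p\<close>, and the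
rank condition becomes a polynomial equation through a Schur complement.

Generic smoothness: every algebraic set that meets an open set \<open>W\<close> has a point in \<open>W\<close> around which
it is a coordinate slice (\<open>algebraic_set_has_smooth_point\<close>). Take as many polynomials with
independent differentials as possible among those vanishing on the set near some point. By
maximality, the polynomials vanishing on the set near that point are stable under differentiation
along the common zero locus of the chosen ones, so the identity theorem makes them vanish on that
whole locus.

So \<open>D\<^sub>a\<close> has a slice chart at one point \<open>q\<close>; the biholomorphic maps \<open>x \<mapsto> g x h\<close> with
\<open>g, h \<in> G\<close> preserve \<open>D\<^sub>a\<close> and carry \<open>q\<close> to any other point of it, so they transport this chart,
with its dimension, to all of \<open>D\<^sub>a\<close>.\<close>

no_notation fps_nth (infixl \<open>$\<close> 75)

section \<open>Generic extension of homomorphisms into the complex numbers\<close>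

text \<open>Rings and their extensions are subsets of one ambient commutative ring. The ambient ring may have
zero divisors, as rings of functions do, so being a domain is a property of the subset.\<close>

definition subring_set :: "'r::comm_ring_1 set \<Rightarrow> bool" where
  "subring_set A \<longleftrightarrow> 1 \<in> A \<and> (\<forall>x\<in>A. - x \<in> A) \<and> (\<forall>x\<in>A. \<forall>y\<in>A. x + y \<in> A \<and> x * y \<in> A)"

definition no_zero_divisors_on :: "'r::comm_ring_1 set \<Rightarrow> bool" where
  "no_zero_divisors_on A \<longleftrightarrow> (\<forall>x\<in>A. \<forall>y\<in>A. x * y = 0 \<longrightarrow> x = 0 \<or> y = 0)"

definition complex_hom_on :: "'r::comm_ring_1 set \<Rightarrow> ('r \<Rightarrow> complex) \<Rightarrow> bool" where
  "complex_hom_on A \<phi> \<longleftrightarrow> \<phi> 1 = 1 \<and>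
     (\<forall>x\<in>A. \<forall>y\<in>A. \<phi> (x + y) = \<phi> x + \<phi> y \<and> \<phi> (x * y) = \<phi> x * \<phi> y)"

definition polys_over :: "'r::comm_ring_1 set \<Rightarrow> 'r poly set" where
  "polys_over A = {P. \<forall>i. coeff P i \<in> A}"

definition adjoin :: "'r::comm_ring_1 set \<Rightarrow> 'r \<Rightarrow> 'r set" where
  "adjoin A t = (\<lambda>P. poly P t) ` polys_over A"

lemma subring_set_closed:
  assumes "subring_set A"
  shows "1 \<in> A" "0 \<in> A" "x \<in> A \<Longrightarrow> - x \<in> A"
    "x \<in> A \<Longrightarrow> y \<in> A \<Longrightarrow> x + y \<in> A" "x \<in> A \<Longrightarrow> y \<in> A \<Longrightarrow> x * y \<in> A"
    "x \<in> A \<Longrightarrow> y \<in> A \<Longrightarrow> x - y \<in> A" "x \<in> A \<Longrightarrow> x ^ n \<in> A"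
proof -
  show 1: "1 \<in> A" using assms by (simp add: subring_set_def)
  show neg: "- x \<in> A" if "x \<in> A" for x using assms that by (simp add: subring_set_def)
  show add: "x + y \<in> A" if "x \<in> A" "y \<in> A" for x y using assms that by (simp add: subring_set_def)
  show mult: "x * y \<in> A" if "x \<in> A" "y \<in> A" for x y using assms that by (simp add: subring_set_def)
  show "0 \<in> A" using add[OF 1 neg[OF 1]] by simp
  show "x - y \<in> A" if "x \<in> A" "y \<in> A" for x y using add[OF that(1) neg[OF that(2)]] by simp
  show "x ^ n \<in> A" if "x \<in> A" for x by (induction n) (auto intro: 1 mult that)
qed

lemma subring_set_sum:
  assumes "subring_set A" "\<And>i. i \<in> I \<Longrightarrow> f i \<in> A"
  shows "sum f I \<in> A"
  using assms(2) by (induction I rule: infinite_finite_induct) (auto intro: subring_set_closed[OF assms(1)])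

lemma polys_over_closed:
  assumes "subring_set A"
  shows "0 \<in> polys_over A" "P \<in> polys_over A \<Longrightarrow> Q \<in> polys_over A \<Longrightarrow> P + Q \<in> polys_over A"
    "P \<in> polys_over A \<Longrightarrow> Q \<in> polys_over A \<Longrightarrow> P - Q \<in> polys_over A"
    "P \<in> polys_over A \<Longrightarrow> Q \<in> polys_over A \<Longrightarrow> P * Q \<in> polys_over A"
    "c \<in> A \<Longrightarrow> P \<in> polys_over A \<Longrightarrow> smult c P \<in> polys_over A"
    "P \<in> polys_over A \<Longrightarrow> - P \<in> polys_over A"
    "c \<in> A \<Longrightarrow> monom c n \<in> polys_over A"
  using assms
  by (auto simp: polys_over_def coeff_mult intro!: subring_set_closed[OF assms] subring_set_sum)

lemma adjoin_mem: "subring_set A \<Longrightarrow> P \<in> polys_over A \<Longrightarrow> poly P t \<in> adjoin A t"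
  by (auto simp: adjoin_def)

lemma subset_adjoin:
  assumes "subring_set A" shows "A \<subseteq> adjoin A t"
proof
  fix x assume "x \<in> A"
  then have "poly (monom x 0) t \<in> adjoin A t"
    using assms by (intro adjoin_mem polys_over_closed)
  then show "x \<in> adjoin A t" by (simp add: poly_monom)
qed

lemma generator_in_adjoin: "subring_set A \<Longrightarrow> t \<in> adjoin A t"
  using adjoin_mem[of A "monom 1 1" t] by (simp add: poly_monom polys_over_closed subring_set_closed)

lemma subring_set_adjoin:
  assumes A: "subring_set A" shows "subring_set (adjoin A t)"
  unfolding subring_set_def
proof (intro conjI ballI)
  show "1 \<in> adjoin A t" using subset_adjoin[OF A] subring_set_closed(1)[OF A] by blast
next
  fix x assume "x \<in> adjoin A t"
  then obtain P where P: "P \<in> polys_over A" "x = poly P t" by (auto simp: adjoin_def)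
  then show "- x \<in> adjoin A t"
    using adjoin_mem[OF A polys_over_closed(6)[OF A P(1)], of t] by simp
  fix y assume "y \<in> adjoin A t"
  then obtain Q where Q: "Q \<in> polys_over A" "y = poly Q t" by (auto simp: adjoin_def)
  show "x + y \<in> adjoin A t" "x * y \<in> adjoin A t"
    using adjoin_mem[OF A polys_over_closed(2)[OF A P(1) Q(1)], of t]
      adjoin_mem[OF A polys_over_closed(4)[OF A P(1) Q(1)], of t] P Q by simp_all
qed

lemma complex_hom_on_simps:
  assumes "subring_set A" "complex_hom_on A \<phi>"
  shows "\<phi> 1 = 1" "\<phi> 0 = 0" "x \<in> A \<Longrightarrow> \<phi> (- x) = - \<phi> x"
    "x \<in> A \<Longrightarrow> y \<in> A \<Longrightarrow> \<phi> (x + y) = \<phi> x + \<phi> y"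
    "x \<in> A \<Longrightarrow> y \<in> A \<Longrightarrow> \<phi> (x * y) = \<phi> x * \<phi> y"
    "x \<in> A \<Longrightarrow> y \<in> A \<Longrightarrow> \<phi> (x - y) = \<phi> x - \<phi> y"
    "x \<in> A \<Longrightarrow> \<phi> (x ^ n) = \<phi> x ^ n"
proof -
  note cl = subring_set_closed[OF assms(1)]
  show one: "\<phi> 1 = 1" using assms by (simp add: complex_hom_on_def)
  show add: "\<phi> (x + y) = \<phi> x + \<phi> y" if "x \<in> A" "y \<in> A" for x y
    using assms that by (simp add: complex_hom_on_def)
  show mult: "\<phi> (x * y) = \<phi> x * \<phi> y" if "x \<in> A" "y \<in> A" for x y
    using assms that by (simp add: complex_hom_on_def)
  show zero: "\<phi> 0 = 0" using add[OF cl(2) cl(2)] by simp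
  show neg: "\<phi> (- x) = - \<phi> x" if "x \<in> A" for x
    using add[OF that cl(3)[OF that]] zero by (simp add: eq_neg_iff_add_eq_0 add.commute)
  show "\<phi> (x - y) = \<phi> x - \<phi> y" if "x \<in> A" "y \<in> A" for x y
    using add[OF that(1) cl(3)[OF that(2)]] neg[OF that(2)] by simp
  show "\<phi> (x ^ n) = \<phi> x ^ n" if "x \<in> A" for x
    by (induction n) (auto simp: one mult that cl)
qed

lemma complex_hom_on_sum:
  assumes A: "subring_set A" and h: "complex_hom_on A \<phi>" and "\<And>i. i \<in> I \<Longrightarrow> f i \<in> A"
  shows "\<phi> (sum f I) = (\<Sum>i\<in>I. \<phi> (f i))"
  using assms(3)
  by (induction I rule: infinite_finite_induct)
    (auto simp: complex_hom_on_simps[OF A h] subring_set_sum[OF A])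

lemma map_poly_hom:
  assumes A: "subring_set A" and h: "complex_hom_on A \<phi>"
    and P: "P \<in> polys_over A" and Q: "Q \<in> polys_over A"
  shows "map_poly \<phi> (P + Q) = map_poly \<phi> P + map_poly \<phi> Q"
    "map_poly \<phi> (P - Q) = map_poly \<phi> P - map_poly \<phi> Q"
    "map_poly \<phi> (P * Q) = map_poly \<phi> P * map_poly \<phi> Q"
    "c \<in> A \<Longrightarrow> map_poly \<phi> (smult c P) = smult (\<phi> c) (map_poly \<phi> P)"
  using P Q
  by (auto simp: poly_eq_iff coeff_map_poly complex_hom_on_simps[OF A h] polys_over_def coeff_mult
       complex_hom_on_sum[OF A h] subring_set_closed[OF A])

text \<open>The formula \<open>F(t) \<mapsto> F\<^sup>\<phi>(z)\<close> is well defined as soon as \<open>z\<close> satisfies the \<open>\<phi>\<close>-image of every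
relation over \<open>A\<close> that \<open>t\<close> satisfies.\<close>

lemma hom_extend_to_adjoin:
  assumes A: "subring_set A" and h: "complex_hom_on A \<phi>"
    and z: "\<And>P. P \<in> polys_over A \<Longrightarrow> poly P t = 0 \<Longrightarrow> poly (map_poly \<phi> P) z = 0"
  obtains \<psi> where "complex_hom_on (adjoin A t) \<psi>" "\<And>x. x \<in> A \<Longrightarrow> \<psi> x = \<phi> x"
    "\<And>P. P \<in> polys_over A \<Longrightarrow> \<psi> (poly P t) = poly (map_poly \<phi> P) z"
proof -
  define \<psi> where "\<psi> x = poly (map_poly \<phi> (SOME P. P \<in> polys_over A \<and> poly P t = x)) z" for x
  have \<psi>: "\<psi> (poly P t) = poly (map_poly \<phi> P) z" if P: "P \<in> polys_over A" for P
  proof -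
    define Q where "Q = (SOME Q. Q \<in> polys_over A \<and> poly Q t = poly P t)"
    have Q: "Q \<in> polys_over A \<and> poly Q t = poly P t"
      unfolding Q_def by (rule someI[of _ P]) (use P in simp)
    then have "poly (map_poly \<phi> (Q - P)) z = 0"
      using P by (intro z polys_over_closed[OF A]) auto
    then show ?thesis
      using map_poly_hom(2)[OF A h, of Q P] Q P by (simp add: \<psi>_def Q_def)
  qed
  have ext: "\<psi> x = \<phi> x" if "x \<in> A" for x
    using \<psi>[of "monom x 0"] that polys_over_closed(7)[OF A that]
    by (simp add: poly_monom map_poly_monom complex_hom_on_simps[OF A h])
  have "complex_hom_on (adjoin A t) \<psi>"
    unfolding complex_hom_on_def
  proof (intro conjI ballI)
    show "\<psi> 1 = 1" using ext[OF subring_set_closed(1)[OF A]] complex_hom_on_simps(1)[OF A h] by simp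
  next
    fix x y assume "x \<in> adjoin A t" "y \<in> adjoin A t"
    then obtain P Q where PQ: "P \<in> polys_over A" "x = poly P t" "Q \<in> polys_over A" "y = poly Q t"
      by (auto simp: adjoin_def)
    show "\<psi> (x + y) = \<psi> x + \<psi> y" "\<psi> (x * y) = \<psi> x * \<psi> y"
      using \<psi>[OF polys_over_closed(2)[OF A PQ(1) PQ(3)]] \<psi>[OF polys_over_closed(4)[OF A PQ(1) PQ(3)]]
      by (auto simp: PQ \<psi> map_poly_hom[OF A h])
  qed
  then show ?thesis using that ext \<psi> by blast
qed

text \<open>Multiplying by the leading coefficient of the divisor at each step, instead of dividing by it, keeps
all coefficients in \<open>A\<close>.\<close>

lemma polys_over_pseudo_division:
  assumes A: "subring_set A" and D: "D \<in> polys_over A" "D \<noteq> 0" and P: "P \<in> polys_over A"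
  shows "\<exists>k Q R. Q \<in> polys_over A \<and> R \<in> polys_over A \<and>
    smult (lead_coeff D ^ k) P = D * Q + R \<and> (R = 0 \<or> degree R < degree D)"
  using P
proof (induction "degree P" arbitrary: P rule: less_induct)
  case less
  note cl = polys_over_closed[OF A]
  have lD: "lead_coeff D \<in> A" and lP: "lead_coeff P \<in> A"
    using D less.prems by (auto simp: polys_over_def)
  show ?case
  proof (cases "P = 0 \<or> degree P < degree D")
    case True
    then show ?thesis
      using less.prems cl(1) by (intro exI[of _ 0] exI[of _ 0] exI[of _ P]) auto
  next
    case False
    define M where "M = monom (lead_coeff P) (degree P - degree D)"
    define P1 where "P1 = smult (lead_coeff D) P - D * M"
    have M: "M \<in> polys_over A" and P1: "P1 \<in> polys_over A"
      using D less.prems lD lP by (auto simp: M_def P1_def intro!: cl)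
    have "degree (D * M) \<le> degree D + degree M" by (rule degree_mult_le)
    also have "\<dots> \<le> degree P"
      using False degree_monom_le[of "lead_coeff P" "degree P - degree D"] by (auto simp: M_def)
    finally have "degree P1 \<le> degree P"
      unfolding P1_def by (intro degree_diff_le) (auto intro: order.trans[OF degree_smult_le])
    moreover have "coeff P1 (degree P) = 0"
    proof -
      have "coeff (M * D) (degree P) = lead_coeff P * lead_coeff D"
        using False by (simp add: M_def coeff_monom_mult)
      then show ?thesis by (simp add: P1_def mult.commute)
    qed
    ultimately have lt: "P1 = 0 \<or> degree P1 < degree P"
      by (metis le_neq_implies_less leading_coeff_0_iff)
    have "\<exists>k Q R. Q \<in> polys_over A \<and> R \<in> polys_over A \<and>
      smult (lead_coeff D ^ k) P1 = D * Q + R \<and> (R = 0 \<or> degree R < degree D)"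
    proof (cases "P1 = 0")
      case True
      then show ?thesis using cl(1) by (intro exI[of _ 0]) auto
    next
      case False
      then show ?thesis using lt less.hyps P1 by blast
    qed
    then obtain k Q R where R: "Q \<in> polys_over A" "R \<in> polys_over A"
      "smult (lead_coeff D ^ k) P1 = D * Q + R" "R = 0 \<or> degree R < degree D" by blast
    have "smult (lead_coeff D ^ Suc k) P = smult (lead_coeff D ^ k) P1 + smult (lead_coeff D ^ k) (D * M)"
      by (simp add: P1_def smult_diff_right mult.commute)
    also have "\<dots> = D * (Q + smult (lead_coeff D ^ k) M) + R"
      by (simp add: R(3) algebra_simps)
    finally show ?thesis
      using R lD M by (intro exI[of _ "Suc k"] exI[of _ "Q + smult (lead_coeff D ^ k) M"] exI[of _ R])
        (auto intro!: cl subring_set_closed[OF A])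
  qed
qed

lemma degree_mult_no_zero_divisors_on:
  assumes "no_zero_divisors_on B" "A \<subseteq> B" "P \<in> polys_over A" "Q \<in> polys_over A" "P \<noteq> 0" "Q \<noteq> 0"
  shows "degree (P * Q) = degree P + degree Q"
proof (rule antisym[OF degree_mult_le])
  have "lead_coeff P * lead_coeff Q \<noteq> 0"
  proof -
    have "lead_coeff P \<in> B" "lead_coeff Q \<in> B" using assms(2-4) by (auto simp: polys_over_def)
    moreover have "lead_coeff P \<noteq> 0" "lead_coeff Q \<noteq> 0" using assms(5,6) by auto
    ultimately show ?thesis using assms(1) unfolding no_zero_divisors_on_def by blast
  qed
  then show "degree P + degree Q \<le> degree (P * Q)"
    by (intro le_degree) (simp add: coeff_mult_degree_sum)
qed

lemma no_zero_divisors_on_power: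
  assumes "no_zero_divisors_on B" "subring_set B" "x \<in> B" "x \<noteq> 0"
  shows "x ^ n \<noteq> 0"
proof (induction n)
  case (Suc n)
  then show ?case
    using assms subring_set_closed(7)[OF assms(2,3)] unfolding no_zero_divisors_on_def by auto
qed (auto)

text \<open>The element \<open>c\<close> plays the role of the resultant of \<open>P\<close> and \<open>R\<close>: away from its zeros, the images of
\<open>P\<close> and \<open>R\<close> have no common root. It is found by the Euclidean algorithm. If
\<open>r\<^sup>k P = R S + R'\<close>, then at a root of \<open>P\<close> the values of \<open>R S\<close> and \<open>R'\<close> are opposite, so a constant
that works for \<open>R'\<close> works for \<open>R\<close>. Minimality of \<open>P\<close> and the absence of zero divisors keep all
remainders nonzero at \<open>t\<close>, so the algorithm ends with a nonzero constant.\<close>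

lemma nonvanishing_at_roots_of_minimal_polynomial:
  assumes A: "subring_set A" and nzd: "no_zero_divisors_on (adjoin A t)"
    and P: "P \<in> polys_over A" "P \<noteq> 0" "poly P t = 0"
    and min: "\<And>Q. Q \<in> polys_over A \<Longrightarrow> Q \<noteq> 0 \<Longrightarrow> poly Q t = 0 \<Longrightarrow> degree P \<le> degree Q"
    and R: "R \<in> polys_over A" "poly R t \<noteq> 0" "degree R < degree P"
  shows "\<exists>c\<in>A. c \<noteq> 0 \<and> (\<forall>\<phi> z. complex_hom_on A \<phi> \<longrightarrow> poly (map_poly \<phi> P) z = 0 \<longrightarrow> \<phi> c \<noteq> 0 \<longrightarrow>
           poly (map_poly \<phi> R) z \<noteq> 0)"
  using R
proof (induction "degree R" arbitrary: R rule: less_induct)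
  case less
  note cl = polys_over_closed[OF A] and B = subring_set_adjoin[OF A, of t]
  have sub: "A \<subseteq> adjoin A t" by (rule subset_adjoin[OF A])
  have R0: "R \<noteq> 0" using less.prems by auto
  show ?case
  proof (cases "degree R = 0")
    case True
    then obtain c where c: "R = [:c:]" by (meson degree_eq_zeroE)
    then have "c \<in> A" "c \<noteq> 0" using less.prems(1) R0 by (auto simp: polys_over_def dest: spec[of _ 0])
    moreover have "poly (map_poly \<phi> R) z = \<phi> c" if "complex_hom_on A \<phi>" for \<phi> z
      using complex_hom_on_simps(2)[OF A that] by (simp add: c map_poly_pCons)
    ultimately show ?thesis by auto
  next
    case False
    obtain k S R' where S: "S \<in> polys_over A" "R' \<in> polys_over A"
      "smult (lead_coeff R ^ k) P = R * S + R'" "R' = 0 \<or> degree R' < degree R"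
      using polys_over_pseudo_division[OF A less.prems(1) R0 P(1)] by blast
    define r where "r = lead_coeff R ^ k"
    have lR: "lead_coeff R \<in> A" "lead_coeff P \<in> A" using less.prems(1) P(1) by (auto simp: polys_over_def)
    have r: "r \<in> A" unfolding r_def by (intro subring_set_closed[OF A] lR)
    have r0: "r \<noteq> 0"
      unfolding r_def using lR sub R0 by (intro no_zero_divisors_on_power[OF nzd B]) auto
    \<comment> \<open>If \<open>S\<close> were zero, \<open>r P\<close> would equal \<open>R'\<close>, whose degree is too small.\<close>
    have "r * lead_coeff P \<noteq> 0"
      using nzd r0 subsetD[OF sub r] subsetD[OF sub lR(2)] P(2)[folded leading_coeff_0_iff]
      unfolding no_zero_divisors_on_def by blast
    then have top: "coeff (R * S + R') (degree P) \<noteq> 0"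
      using arg_cong[OF S(3), of "\<lambda>p. coeff p (degree P)"] by (simp add: r_def)
    have degR': "degree R' < degree P" using S(4) less.prems(3) False by auto
    have S0: "S \<noteq> 0"
      using top degR' by (auto simp: coeff_eq_0)
    have "degree (R * S) = degree R + degree S"
      by (rule degree_mult_no_zero_divisors_on[OF nzd sub less.prems(1) S(1) R0 S0])
    moreover have "degree (R * S) \<le> degree P"
    proof -
      have "R * S = smult r P - R'" using S(3) by (simp add: r_def)
      then show ?thesis
        using degR' by (auto intro!: degree_diff_le order.trans[OF degree_smult_le])
    qed
    ultimately have "degree S < degree P" using False by simp
    then have St: "poly S t \<noteq> 0" using min[OF S(1) S0] by auto
    have ev: "poly R t * poly S t + poly R' t = 0"
      using arg_cong[OF S(3), of "\<lambda>p. poly p t"] P(3) by simp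
    have "poly R t * poly S t \<noteq> 0"
      using nzd less.prems(2) St adjoin_mem[OF A less.prems(1)] adjoin_mem[OF A S(1)]
      unfolding no_zero_divisors_on_def by blast
    then have R't: "poly R' t \<noteq> 0" using ev by auto
    then have "degree R' < degree R" using S(4) by auto
    from less.hyps[OF this S(2) R't degR'] obtain c where c: "c \<in> A" "c \<noteq> 0"
      "\<And>\<phi> z. complex_hom_on A \<phi> \<Longrightarrow> poly (map_poly \<phi> P) z = 0 \<Longrightarrow> \<phi> c \<noteq> 0 \<Longrightarrow> poly (map_poly \<phi> R') z \<noteq> 0"
      by blast
    have "poly (map_poly \<phi> R) z \<noteq> 0"
      if h: "complex_hom_on A \<phi>" and z: "poly (map_poly \<phi> P) z = 0" and "\<phi> c \<noteq> 0" for \<phi> z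
    proof -
      have "smult (\<phi> r) (map_poly \<phi> P) = map_poly \<phi> R * map_poly \<phi> S + map_poly \<phi> R'"
        using arg_cong[OF S(3), of "map_poly \<phi>"] less.prems(1) S(1,2) P(1) r
        by (simp add: r_def map_poly_hom[OF A h] cl)
      from arg_cong[OF this, of "\<lambda>p. poly p z"]
      have "poly (map_poly \<phi> R) z * poly (map_poly \<phi> S) z + poly (map_poly \<phi> R') z = 0"
        using z by simp
      then show ?thesis using c(3)[OF that] by auto
    qed
    then show ?thesis using c(1,2) by blast
  qed
qed

text \<open>If \<open>t\<close> is transcendental over \<open>A\<close>, any \<open>z\<close> may be taken as the image of \<open>t\<close>, and all but finitely
many of them keep \<open>b\<close> nonzero, provided that the leading coefficient of \<open>b\<close> as a polynomial in \<open>t\<close>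
survives under \<open>\<phi>\<close>. If \<open>t\<close> is algebraic, its image must be a root \<open>z\<close> of the image of
its minimal polynomial \<open>P\<close>. When the leading coefficient \<open>p\<close> of \<open>P\<close> survives under \<open>\<phi>\<close>, such a root
exists and satisfies all relations of \<open>t\<close>, because pseudo-division reduces each of them to \<open>P\<close>; and
\<open>b\<close>, which up to a power of \<open>p\<close> is \<open>R(t)\<close> with \<open>R\<close> of smaller degree than \<open>P\<close>, stays nonzero when
the constant of the previous lemma does.\<close>

lemma hom_extension_one_generator:
  assumes A: "subring_set A" and nzd: "no_zero_divisors_on (adjoin A t)"
    and b: "b \<in> adjoin A t" "b \<noteq> 0"
  shows "\<exists>a\<in>A. a \<noteq> 0 \<and> (\<forall>\<phi>. complex_hom_on A \<phi> \<longrightarrow> \<phi> a \<noteq> 0 \<longrightarrow>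
    (\<exists>\<psi>. complex_hom_on (adjoin A t) \<psi> \<and> (\<forall>x\<in>A. \<psi> x = \<phi> x) \<and> \<psi> b \<noteq> 0))"
proof -
  note cl = polys_over_closed[OF A] and B = subring_set_adjoin[OF A, of t]
  have sub: "A \<subseteq> adjoin A t" by (rule subset_adjoin[OF A])
  obtain Q where Q: "Q \<in> polys_over A" "b = poly Q t" using b by (auto simp: adjoin_def)
  show ?thesis
  proof (cases "\<exists>P\<in>polys_over A. P \<noteq> 0 \<and> poly P t = 0")
    case False
    have Q0: "Q \<noteq> 0" using Q b by auto
    have "\<exists>\<psi>. complex_hom_on (adjoin A t) \<psi> \<and> (\<forall>x\<in>A. \<psi> x = \<phi> x) \<and> \<psi> b \<noteq> 0"
      if h: "complex_hom_on A \<phi>" and "\<phi> (lead_coeff Q) \<noteq> 0" for \<phi>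
    proof -
      have "coeff (map_poly \<phi> Q) (degree Q) \<noteq> 0"
        using that by (simp add: coeff_map_poly complex_hom_on_simps[OF A h])
      then have "map_poly \<phi> Q \<noteq> 0" by auto
      then have "{z. poly (map_poly \<phi> Q) z = 0} \<noteq> UNIV"
        using poly_roots_finite infinite_UNIV_char_0 by metis
      then obtain z where z: "poly (map_poly \<phi> Q) z \<noteq> 0" by blast
      obtain \<psi> where "complex_hom_on (adjoin A t) \<psi>" "\<And>x. x \<in> A \<Longrightarrow> \<psi> x = \<phi> x"
        "\<And>P. P \<in> polys_over A \<Longrightarrow> \<psi> (poly P t) = poly (map_poly \<phi> P) z"
        using hom_extend_to_adjoin[OF A h, of t z] False by (metis map_poly_0 poly_0)
      then show ?thesis using Q z by auto
    qed
    moreover have "lead_coeff Q \<in> A" "lead_coeff Q \<noteq> 0" using Q Q0 by (auto simp: polys_over_def)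
    ultimately show ?thesis by blast
  next
    case True
    define P where "P = arg_min degree (\<lambda>P. P \<in> polys_over A \<and> P \<noteq> 0 \<and> poly P t = 0)"
    have "P \<in> polys_over A \<and> P \<noteq> 0 \<and> poly P t = 0"
    proof -
      obtain P0 where "P0 \<in> polys_over A \<and> P0 \<noteq> 0 \<and> poly P0 t = 0" using True by blast
      then show ?thesis unfolding P_def by (rule arg_min_natI)
    qed
    then have P: "P \<in> polys_over A" "P \<noteq> 0" "poly P t = 0" by auto
    have min: "degree P \<le> degree Q" if "Q \<in> polys_over A" "Q \<noteq> 0" "poly Q t = 0" for Q
      unfolding P_def by (rule arg_min_nat_le) (use that in auto)
    define p where "p = lead_coeff P"
    have p: "p \<in> A" "p \<noteq> 0" using P by (auto simp: p_def polys_over_def)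
    have degP: "degree P \<noteq> 0"
    proof
      assume "degree P = 0"
      then obtain c where "P = [:c:]" by (meson degree_eq_zeroE)
      then show False using P by auto
    qed
    have div: "\<exists>k S R. S \<in> polys_over A \<and> R \<in> polys_over A \<and> smult (p ^ k) F = P * S + R \<and> degree R < degree P"
      if "F \<in> polys_over A" for F
      using polys_over_pseudo_division[OF A P(1,2) that] degP unfolding p_def
      by (metis bot_nat_0.not_eq_extremum degree_0)
    obtain k S R where S: "S \<in> polys_over A" "R \<in> polys_over A" "smult (p ^ k) Q = P * S + R" "degree R < degree P"
      using div[OF Q(1)] by blast
    have "poly R t = p ^ k * b"
      using arg_cong[OF S(3), of "\<lambda>p. poly p t"] P(3) Q by simp
    moreover have "p ^ k \<noteq> 0" using p sub by (intro no_zero_divisors_on_power[OF nzd B]) auto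
    ultimately have Rt: "poly R t \<noteq> 0"
      using nzd b sub subring_set_closed(7)[OF A p(1)] unfolding no_zero_divisors_on_def by auto
    obtain c where c: "c \<in> A" "c \<noteq> 0"
      "\<And>\<phi> z. complex_hom_on A \<phi> \<Longrightarrow> poly (map_poly \<phi> P) z = 0 \<Longrightarrow> \<phi> c \<noteq> 0 \<Longrightarrow> poly (map_poly \<phi> R) z \<noteq> 0"
      using nonvanishing_at_roots_of_minimal_polynomial[OF A nzd P min S(2) Rt S(4)] by blast
    have "\<exists>\<psi>. complex_hom_on (adjoin A t) \<psi> \<and> (\<forall>x\<in>A. \<psi> x = \<phi> x) \<and> \<psi> b \<noteq> 0"
      if h: "complex_hom_on A \<phi>" and nz: "\<phi> (c * p) \<noteq> 0" for \<phi>
    proof -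
      have cp: "\<phi> c \<noteq> 0" "\<phi> p \<noteq> 0" using nz p c by (auto simp: complex_hom_on_simps[OF A h])
      have "coeff (map_poly \<phi> P) (degree P) \<noteq> 0"
        using cp by (simp add: coeff_map_poly complex_hom_on_simps[OF A h] p_def)
      then have "degree (map_poly \<phi> P) \<noteq> 0" using degP le_degree by fastforce
      then have "\<not> (\<exists>a l. a \<noteq> 0 \<and> l = 0 \<and> map_poly \<phi> P = pCons a l)" by auto
      then obtain z where z: "poly (map_poly \<phi> P) z = 0" using fundamental_theorem_of_algebra_alt by blast
      have "poly (map_poly \<phi> F) z = 0" if F: "F \<in> polys_over A" "poly F t = 0" for F
      proof -
        obtain k S R where S: "S \<in> polys_over A" "R \<in> polys_over A" "smult (p ^ k) F = P * S + R" "degree R < degree P"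
          using div[OF F(1)] by blast
        have "poly R t = 0" using arg_cong[OF S(3), of "\<lambda>p. poly p t"] P(3) F by simp
        then have R0: "R = 0" using min[OF S(2)] S(4) by (metis leD)
        have "smult (\<phi> p ^ k) (map_poly \<phi> F) = map_poly \<phi> P * map_poly \<phi> S"
          using arg_cong[OF S(3), of "map_poly \<phi>"] map_poly_hom(4)[OF A h F(1) F(1), of "p ^ k"]
            map_poly_hom(3)[OF A h P(1) S(1)] p
          by (simp add: R0 complex_hom_on_simps[OF A h] subring_set_closed[OF A])
        from arg_cong[OF this, of "\<lambda>p. poly p z"] show ?thesis using z cp by simp
      qed
      then obtain \<psi> where \<psi>: "complex_hom_on (adjoin A t) \<psi>" "\<And>x. x \<in> A \<Longrightarrow> \<psi> x = \<phi> x"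
        "\<And>P. P \<in> polys_over A \<Longrightarrow> \<psi> (poly P t) = poly (map_poly \<phi> P) z"
        using hom_extend_to_adjoin[OF A h, of t z] by blast
      have "\<psi> (poly R t) \<noteq> 0" using \<psi>(3)[OF S(2)] c(3)[OF h z cp(1)] by simp
      then have "\<psi> (p ^ k * b) \<noteq> 0" using \<open>poly R t = p ^ k * b\<close> by simp
      then have "\<psi> b \<noteq> 0"
        using complex_hom_on_simps(5)[OF B \<psi>(1) _ b(1)] subring_set_closed(7)[OF A p(1)] sub
        by (metis mult_eq_0_iff subsetD)
      then show ?thesis using \<psi> by blast
    qed
    moreover have "c * p \<in> A" using c p by (intro subring_set_closed[OF A])
    moreover have "c * p \<noteq> 0"
      using nzd subsetD[OF sub c(1)] subsetD[OF sub p(1)] c(2) p(2) unfolding no_zero_divisors_on_def by blast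
    ultimately show ?thesis by blast
  qed
qed

fun adjoin_list :: "'r::comm_ring_1 set \<Rightarrow> 'r list \<Rightarrow> 'r set" where
  "adjoin_list A [] = A"
| "adjoin_list A (t # ts) = adjoin_list (adjoin A t) ts"

lemma adjoin_list_props:
  assumes "subring_set A"
  shows "subring_set (adjoin_list A ts)" "A \<subseteq> adjoin_list A ts" "set ts \<subseteq> adjoin_list A ts"
  using assms
proof (induction ts arbitrary: A)
  case (Cons t ts)
  { case 1 then show ?case using Cons.IH(1) by (simp add: subring_set_adjoin) }
  { case 2 then show ?case using Cons.IH(2)[OF subring_set_adjoin[OF 2]] subset_adjoin[OF 2] by auto }
  { case 3 then show ?case
      using Cons.IH(2,3)[OF subring_set_adjoin[OF 3, of t]] generator_in_adjoin[OF 3, of t] by auto }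
qed auto

lemma adjoin_list_least:
  assumes "subring_set A" "subring_set B" "A \<subseteq> B" "set ts \<subseteq> B"
  shows "adjoin_list A ts \<subseteq> B"
  using assms
proof (induction ts arbitrary: A)
  case (Cons t ts)
  have "adjoin A t \<subseteq> B"
  proof
    fix x assume "x \<in> adjoin A t"
    then obtain P where P: "P \<in> polys_over A" "x = poly P t" by (auto simp: adjoin_def)
    have "coeff P i * t ^ i \<in> B" for i
    proof (intro subring_set_closed[OF Cons.prems(2)])
      show "coeff P i \<in> B" using P(1) Cons.prems(3) by (auto simp: polys_over_def)
      show "t \<in> B" using Cons.prems(4) by simp
    qed
    then show "x \<in> B" by (simp add: P poly_altdef subring_set_sum[OF Cons.prems(2)])
  qed
  then show ?case using Cons by (simp add: subring_set_adjoin)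
qed auto

text \<open>Chevalley's theorem in algebraic form. The condition \<open>b \<noteq> 0\<close> is pushed down the tower one generator
at a time: the element \<open>a\<close> found at one stage is the element to be kept nonzero at the next.\<close>

lemma hom_extension_finitely_generated:
  assumes "subring_set A" "no_zero_divisors_on (adjoin_list A ts)"
    and "b \<in> adjoin_list A ts" "b \<noteq> 0"
  shows "\<exists>a\<in>A. a \<noteq> 0 \<and> (\<forall>\<phi>. complex_hom_on A \<phi> \<longrightarrow> \<phi> a \<noteq> 0 \<longrightarrow>
    (\<exists>\<psi>. complex_hom_on (adjoin_list A ts) \<psi> \<and> (\<forall>x\<in>A. \<psi> x = \<phi> x) \<and> \<psi> b \<noteq> 0))"
  using assms
proof (induction ts arbitrary: A)
  case Nil
  then show ?case by auto
next
  case (Cons t ts)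
  note A = Cons.prems(1) and A' = subring_set_adjoin[OF Cons.prems(1), of t]
  obtain a' where a': "a' \<in> adjoin A t" "a' \<noteq> 0"
    "\<And>\<phi>. complex_hom_on (adjoin A t) \<phi> \<Longrightarrow> \<phi> a' \<noteq> 0 \<Longrightarrow>
      \<exists>\<psi>. complex_hom_on (adjoin_list A (t # ts)) \<psi> \<and> (\<forall>x\<in>adjoin A t. \<psi> x = \<phi> x) \<and> \<psi> b \<noteq> 0"
    using Cons.IH[OF A'] Cons.prems by auto
  have "no_zero_divisors_on (adjoin A t)"
    using Cons.prems(2) adjoin_list_props(2)[OF A', of ts] unfolding no_zero_divisors_on_def by auto
  from hom_extension_one_generator[OF A this a'(1,2)]
  obtain a where a: "a \<in> A" "a \<noteq> 0" "\<And>\<phi>. complex_hom_on A \<phi> \<Longrightarrow> \<phi> a \<noteq> 0 \<Longrightarrow>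
      \<exists>\<psi>. complex_hom_on (adjoin A t) \<psi> \<and> (\<forall>x\<in>A. \<psi> x = \<phi> x) \<and> \<psi> a' \<noteq> 0"
    by blast
  show ?case
  proof (intro bexI[OF _ a(1)] conjI a(2) allI impI)
    fix \<phi> assume "complex_hom_on A \<phi>" "\<phi> a \<noteq> 0"
    then obtain \<psi> where \<psi>: "complex_hom_on (adjoin A t) \<psi>" "\<forall>x\<in>A. \<psi> x = \<phi> x" "\<psi> a' \<noteq> 0"
      using a(3) by blast
    with a'(3) obtain \<omega> where "complex_hom_on (adjoin_list A (t # ts)) \<omega>"
      "\<forall>x\<in>adjoin A t. \<omega> x = \<psi> x" "\<omega> b \<noteq> 0" by blast
    then show "\<exists>\<psi>. complex_hom_on (adjoin_list A (t # ts)) \<psi> \<and> (\<forall>x\<in>A. \<psi> x = \<phi> x) \<and> \<psi> b \<noteq> 0"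
      using \<psi>(2) subset_adjoin[OF A, of t] by (intro exI[of _ \<omega>]) auto
  qed
qed

section \<open>Polynomial maps and irreducible algebraic sets\<close>

lemma matrix_polynomial_sum:
  assumes "\<And>i. i \<in> I \<Longrightarrow> matrix_polynomial (f i)"
  shows "matrix_polynomial (\<lambda>A. \<Sum>i\<in>I. f i A)"
  using assms by (induction I rule: infinite_finite_induct) (auto intro: matrix_polynomial.intros)

lemma matrix_polynomial_prod:
  assumes "\<And>i. i \<in> I \<Longrightarrow> matrix_polynomial (f i)"
  shows "matrix_polynomial (\<lambda>A. \<Prod>i\<in>I. f i A)"
  using assms by (induction I rule: infinite_finite_induct) (auto intro: matrix_polynomial.intros)

lemma matrix_polynomial_diff:
  assumes "matrix_polynomial p" "matrix_polynomial q"
  shows "matrix_polynomial (\<lambda>A. p A - q A)"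
  using matrix_polynomial.add[OF assms(1) matrix_polynomial.mult[OF matrix_polynomial.const[of "-1"] assms(2)]]
  by simp

lemma matrix_polynomial_det:
  fixes F :: "complex ^ 'n ^ 'n \<Rightarrow> complex ^ 'm ^ 'm"
  assumes "\<And>i j. matrix_polynomial (\<lambda>A. F A $ i $ j)"
  shows "matrix_polynomial (\<lambda>A. det (F A))"
  unfolding det_def
  by (intro matrix_polynomial_sum matrix_polynomial.mult matrix_polynomial.const matrix_polynomial_prod assms)

definition polynomial_map :: "(complex ^ 'n ^ 'n \<Rightarrow> complex ^ 'm ^ 'm) \<Rightarrow> bool" where
  "polynomial_map F \<longleftrightarrow> (\<forall>i j. matrix_polynomial (\<lambda>A. F A $ i $ j))"

lemma polynomial_map_intros:
  "polynomial_map (\<lambda>A. C)" "polynomial_map (\<lambda>A. A)"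
  "polynomial_map F \<Longrightarrow> polynomial_map G \<Longrightarrow> polynomial_map (\<lambda>A. F A + G A)"
  "polynomial_map F \<Longrightarrow> polynomial_map G \<Longrightarrow> polynomial_map (\<lambda>A. F A - G A)"
  "polynomial_map F \<Longrightarrow> polynomial_map G \<Longrightarrow> polynomial_map (\<lambda>A. F A ** G A)"
  by (auto simp: polynomial_map_def matrix_matrix_mult_def
      intro!: matrix_polynomial.intros matrix_polynomial_sum matrix_polynomial_diff)

lemma matrix_polynomial_compose:
  assumes "matrix_polynomial p" "polynomial_map F"
  shows "matrix_polynomial (\<lambda>A. p (F A))"
  using assms by (induction rule: matrix_polynomial.induct)
    (auto intro: matrix_polynomial.intros simp: polynomial_map_def)

text \<open>The coordinate ring of an irreducible set is a domain: \<open>M\<close> is the union of its intersections with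
the zero sets of the two factors.\<close>

lemma irreducible_no_zero_divisors:
  assumes M: "algebraic_set M" "irreducible_set M"
    and p: "matrix_polynomial p" and q: "matrix_polynomial q"
    and pq: "\<And>A. A \<in> M \<Longrightarrow> p A * q A = 0"
  shows "(\<forall>A\<in>M. p A = 0) \<or> (\<forall>A\<in>M. q A = 0)"
proof (rule ccontr)
  assume contra: "\<not> ?thesis"
  obtain P where P: "\<forall>p\<in>P. matrix_polynomial p" "M = {A. \<forall>p\<in>P. p A = 0}"
    using M(1) unfolding algebraic_set_def by blast
  have alg: "algebraic_set (M \<inter> {A. r A = 0})" if "matrix_polynomial r" for r
    unfolding algebraic_set_def by (rule exI[of _ "insert r P"]) (use P that in auto)
  have "M = (M \<inter> {A. p A = 0}) \<union> (M \<inter> {A. q A = 0})" using pq by auto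
  moreover have "M \<inter> {A. p A = 0} \<subset> M" "M \<inter> {A. q A = 0} \<subset> M" using contra by auto
  ultimately show False using M(2) alg[OF p] alg[OF q] unfolding irreducible_set_def by blast
qed

text \<open>Chevalley's theorem for the restriction of \<open>F\<close> to \<open>{g \<in> M. u g \<noteq> 0}\<close>: its image contains a Zariski-dense
open part of \<open>F ` M\<close>. The points of \<open>M\<close> are the homomorphisms from its coordinate ring to \<open>\<complex>\<close>.
Evaluation at \<open>m\<close>, restricted to the subring of functions that factor through \<open>F\<close>, depends on \<open>F m\<close>
only; an extension of it to the whole coordinate ring that does not kill \<open>u\<close> is evaluation at a
point \<open>g\<close> of the fibre of \<open>F m\<close> with \<open>u g \<noteq> 0\<close>.\<close>

lemma fibre_meets_nonvanishing_locus:
  fixes M :: "(complex ^ 'n ^ 'n) set" and F :: "complex ^ 'n ^ 'n \<Rightarrow> complex ^ 'n ^ 'n"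
  assumes M: "algebraic_set M" "irreducible_set M" and F: "polynomial_map F"
    and u: "matrix_polynomial u" and m0: "m0 \<in> M" "u m0 \<noteq> 0"
  obtains p where "matrix_polynomial p" "\<exists>m\<in>M. p (F m) \<noteq> 0"
    "\<And>m. m \<in> M \<Longrightarrow> p (F m) \<noteq> 0 \<Longrightarrow> \<exists>g\<in>M. u g \<noteq> 0 \<and> F g = F m"
proof -
  \<comment> \<open>The retraction \<open>\<rho>\<close> onto \<open>M\<close> turns "equal on \<open>M\<close>" into equality of functions, so that the
    coordinate ring of \<open>M\<close> becomes a subring of the ring of all functions.\<close>
  define \<rho> where "\<rho> A = (if A \<in> M then A else m0)" for A
  have \<rho>: "\<rho> A \<in> M" "A \<in> M \<Longrightarrow> \<rho> A = A" for A using m0 by (auto simp: \<rho>_def)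
  define A0 where "A0 = {f. \<exists>p. matrix_polynomial p \<and> f = (\<lambda>A. p (F (\<rho> A)))}"
  define B0 where "B0 = {f. \<exists>p. matrix_polynomial p \<and> f = (\<lambda>A. p (\<rho> A))}"
  have ring: "subring_set {f. \<exists>p. matrix_polynomial p \<and> f = (\<lambda>A. p (h A))}" for h :: "complex ^ 'n ^ 'n \<Rightarrow> complex ^ 'n ^ 'n"
    unfolding subring_set_def
  proof (intro conjI ballI)
    show "1 \<in> {f. \<exists>p. matrix_polynomial p \<and> f = (\<lambda>A. p (h A))}"
      by (auto simp: fun_eq_iff intro!: exI[of _ "\<lambda>_. 1"] matrix_polynomial.const)
    fix x assume "x \<in> {f. \<exists>p. matrix_polynomial p \<and> f = (\<lambda>A. p (h A))}"
    then obtain p where p: "matrix_polynomial p" "x = (\<lambda>A. p (h A))" by auto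
    show "- x \<in> {f. \<exists>p. matrix_polynomial p \<and> f = (\<lambda>A. p (h A))}"
      using matrix_polynomial_diff[OF matrix_polynomial.const[of 0] p(1)] p(2)
      by (auto simp: fun_eq_iff intro!: exI[of _ "\<lambda>A. 0 - p A"])
    fix y assume "y \<in> {f. \<exists>p. matrix_polynomial p \<and> f = (\<lambda>A. p (h A))}"
    then obtain q where q: "matrix_polynomial q" "y = (\<lambda>A. q (h A))" by auto
    show "x + y \<in> {f. \<exists>p. matrix_polynomial p \<and> f = (\<lambda>A. p (h A))}"
      using matrix_polynomial.add[OF p(1) q(1)] p(2) q(2)
      by (auto simp: fun_eq_iff intro!: exI[of _ "\<lambda>A. p A + q A"])
    show "x * y \<in> {f. \<exists>p. matrix_polynomial p \<and> f = (\<lambda>A. p (h A))}"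
      using matrix_polynomial.mult[OF p(1) q(1)] p(2) q(2)
      by (auto simp: fun_eq_iff intro!: exI[of _ "\<lambda>A. p A * q A"])
  qed
  have A0: "subring_set A0" using ring[of "\<lambda>A. F (\<rho> A)"] by (simp add: A0_def)
  have B0: "subring_set B0" using ring[of \<rho>] by (simp add: B0_def)
  define x where "x = (\<lambda>(i, j) A. \<rho> A $ i $ j)"
  obtain ss :: "('n \<times> 'n) list" where ss: "set ss = UNIV" using finite_list[OF finite[of UNIV]] by blast
  define ts where "ts = map x ss"
  have ts: "set ts = range x" by (simp add: ts_def ss)
  define B where "B = adjoin_list A0 ts"
  have B: "subring_set B" "A0 \<subseteq> B" "range x \<subseteq> B"
    using adjoin_list_props[OF A0, of ts] by (auto simp: B_def ts)
  have "A0 \<subseteq> B0"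
    unfolding A0_def B0_def using matrix_polynomial_compose[OF _ F] by blast
  moreover have "range x \<subseteq> B0"
    by (auto simp: x_def B0_def intro!: exI[of _ "\<lambda>A. A $ _ $ _"] matrix_polynomial.entry)
  ultimately have "B \<subseteq> B0"
    unfolding B_def by (intro adjoin_list_least A0 B0) (auto simp: ts)
  have nzd: "no_zero_divisors_on B"
    unfolding no_zero_divisors_on_def
  proof (intro ballI impI)
    fix f g assume "f \<in> B" "g \<in> B" and fg: "f * g = 0"
    then have "f \<in> B0" "g \<in> B0" using \<open>B \<subseteq> B0\<close> by auto
    then obtain p q where p: "matrix_polynomial p" "f = (\<lambda>A. p (\<rho> A))"
      and q: "matrix_polynomial q" "g = (\<lambda>A. q (\<rho> A))"
      unfolding B0_def by blast
    have "p A * q A = 0" if "A \<in> M" for A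
      using fun_cong[OF fg, of A] that p q \<rho> by simp
    from irreducible_no_zero_divisors[OF M p(1) q(1) this]
    show "f = 0 \<or> g = 0" using p q \<rho> by (auto simp: fun_eq_iff)
  qed
  have constB: "(\<lambda>A. c) \<in> A0" for c
    by (auto simp: A0_def intro!: exI[of _ "\<lambda>A. c"] matrix_polynomial.const)
  have polyB: "(\<lambda>A. p (\<rho> A)) \<in> B" if "matrix_polynomial p" for p
    using that
  proof (induction rule: matrix_polynomial.induct)
    case (const c) then show ?case using constB B(2) by blast
  next
    case (entry i j)
    then show ?case using B(3) by (auto simp: x_def dest: subsetD[OF _ rangeI[of _ "(i, j)"]])
  next
    case (add p q) then show ?case using subring_set_closed(4)[OF B(1) add.IH] by (simp add: plus_fun_def)
  next
    case (mult p q) then show ?case using subring_set_closed(5)[OF B(1) mult.IH] by (simp add: times_fun_def)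
  qed
  have "(\<lambda>A. u (\<rho> A)) \<noteq> 0" using m0 \<rho>(2)[OF m0(1)] by (metis zero_fun_apply)
  then obtain a where a: "a \<in> A0" "a \<noteq> 0" and ext: "\<And>\<phi>. complex_hom_on A0 \<phi> \<Longrightarrow> \<phi> a \<noteq> 0 \<Longrightarrow>
    \<exists>\<psi>. complex_hom_on B \<psi> \<and> (\<forall>x\<in>A0. \<psi> x = \<phi> x) \<and> \<psi> (\<lambda>A. u (\<rho> A)) \<noteq> 0"
    using hom_extension_finitely_generated[OF A0 nzd[unfolded B_def] polyB[OF u, unfolded B_def]]
    unfolding B_def by blast
  obtain p where p: "matrix_polynomial p" "a = (\<lambda>A. p (F (\<rho> A)))" using a by (auto simp: A0_def)
  show thesis
  proof (rule that[OF p(1)])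
    show "\<exists>m\<in>M. p (F m) \<noteq> 0" using a(2) p(2) \<rho> by (auto simp: fun_eq_iff)
    fix m assume m: "m \<in> M" "p (F m) \<noteq> 0"
    have "complex_hom_on A0 (\<lambda>f. f m)" by (simp add: complex_hom_on_def)
    from ext[OF this] obtain \<psi> where \<psi>: "complex_hom_on B \<psi>" "\<And>f. f \<in> A0 \<Longrightarrow> \<psi> f = f m"
      "\<psi> (\<lambda>A. u (\<rho> A)) \<noteq> 0" using m \<rho> p by auto
    define g where "g = (\<chi> i j. \<psi> (x (i, j)))"
    have ev: "\<psi> (\<lambda>A. q (\<rho> A)) = q g" if "matrix_polynomial q" for q
      using that
    proof (induction rule: matrix_polynomial.induct)
      case (const c) then show ?case using \<psi>(2)[OF constB] by simp
    next
      case (entry i j) then show ?case by (simp add: g_def x_def)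
    next
      case (add p q)
      then show ?case
        using complex_hom_on_simps(4)[OF B(1) \<psi>(1) polyB[OF add.hyps(1)] polyB[OF add.hyps(2)]]
        by (simp add: plus_fun_def)
    next
      case (mult p q)
      then show ?case
        using complex_hom_on_simps(5)[OF B(1) \<psi>(1) polyB[OF mult.hyps(1)] polyB[OF mult.hyps(2)]]
        by (simp add: times_fun_def)
    qed
    obtain P where P: "\<forall>p\<in>P. matrix_polynomial p" "M = {A. \<forall>p\<in>P. p A = 0}"
      using M(1) unfolding algebraic_set_def by blast
    have "q g = 0" if "q \<in> P" for q
    proof -
      have "(\<lambda>A. q (\<rho> A)) = 0" using \<rho>(1) P that by (auto simp: fun_eq_iff)
      then show ?thesis using ev[of q] P that complex_hom_on_simps(2)[OF B(1) \<psi>(1)] by auto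
    qed
    then have "g \<in> M" using P by blast
    moreover have "u g \<noteq> 0" using ev[OF u] \<psi>(3) by simp
    moreover have "F g $ i $ j = F m $ i $ j" for i j
    proof -
      have "F g $ i $ j = \<psi> (\<lambda>A. F (\<rho> A) $ i $ j)"
        using ev[of "\<lambda>A. F A $ i $ j"] F by (simp add: polynomial_map_def)
      also have "\<dots> = F (\<rho> m) $ i $ j"
        by (rule \<psi>(2)) (auto simp: A0_def intro!: exI[of _ "\<lambda>A. A $ i $ j"] matrix_polynomial.entry)
      finally show ?thesis using m \<rho> by simp
    qed
    ultimately show "\<exists>g\<in>M. u g \<noteq> 0 \<and> F g = F m" by (auto simp: vec_eq_iff)
  qed
qed


section \<open>Inverses of units\<close>

interpretation fun_space: vector_space "\<lambda>(c::complex) (h::'a \<Rightarrow> complex) A. c * h A"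
  by standard (auto simp: fun_eq_iff algebra_simps)

lemma sum_fun_apply: "(\<Sum>i\<in>I. f i) A = (\<Sum>i\<in>I. f i A)"
  by (induction I rule: infinite_finite_induct) auto

lemma span_pointwise_products:
  assumes f: "f \<in> fun_space.span B" and h: "h \<in> fun_space.span C"
  shows "(\<lambda>A. f A * h A) \<in> fun_space.span {\<lambda>A. b A * c A |b c. b \<in> B \<and> c \<in> C}" (is "_ \<in> fun_space.span ?D")
  using f
proof (induction rule: fun_space.span_induct)
  case base
  show ?case
    by (auto simp: fun_space.subspace_def algebra_simps plus_fun_def zero_fun_def
        intro: fun_space.span_zero[unfolded zero_fun_def] fun_space.span_scale
        dest: fun_space.span_add[of _ ?D, unfolded plus_fun_def])
next
  case (step b)
  show ?case using h
  proof (induction rule: fun_space.span_induct)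
    case base
    show ?case
      by (auto simp: fun_space.subspace_def algebra_simps plus_fun_def zero_fun_def
          intro: fun_space.span_zero[unfolded zero_fun_def] fun_space.span_scale
          dest: fun_space.span_add[of _ ?D, unfolded plus_fun_def])
  next
    case (step c)
    show ?case by (rule fun_space.span_base) (use \<open>b \<in> B\<close> step in auto)
  qed
qed

text \<open>Left translation by \<open>g\<close> preserves a finite-dimensional space containing \<open>f\<close>, because it preserves
the span of the entries in each column, and finite-dimensional invariant spaces can be added and
multiplied.\<close>

lemma translates_span_finite_dimension:
  assumes "matrix_polynomial f"
  shows "\<exists>B. finite B \<and> f \<in> fun_space.span B \<and> (\<forall>h\<in>B. (\<lambda>A. h (g ** A)) \<in> fun_space.span B)"
  using assms
proof (induction rule: matrix_polynomial.induct)
  case (const c)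
  have "(\<lambda>A. c * 1) \<in> fun_space.span {\<lambda>A. 1}"
    by (intro fun_space.span_scale[of "\<lambda>A. 1"] fun_space.span_base) auto
  then show ?case by (intro exI[of _ "{\<lambda>A. 1}"]) (auto intro: fun_space.span_base)
next
  case (entry i j)
  let ?B = "range (\<lambda>k (A::complex^'a^'a). A $ k $ j)"
  have "(\<lambda>A. (g ** A) $ l $ j) \<in> fun_space.span ?B" for l
  proof -
    have "(\<Sum>k\<in>UNIV. (\<lambda>A. g $ l $ k * A $ k $ j)) \<in> fun_space.span ?B"
      by (intro fun_space.span_sum fun_space.span_scale fun_space.span_base) auto
    also have "(\<Sum>k\<in>UNIV. (\<lambda>A. g $ l $ k * A $ k $ j)) = (\<lambda>A. (g ** A) $ l $ j)"
      by (auto simp: fun_eq_iff matrix_matrix_mult_def sum_fun_apply)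
    finally show ?thesis .
  qed
  then show ?case by (intro exI[of _ ?B]) (auto intro: fun_space.span_base)
next
  case (add p q)
  then obtain B C where B: "finite B" "p \<in> fun_space.span B" "\<forall>h\<in>B. (\<lambda>A. h (g ** A)) \<in> fun_space.span B"
    and C: "finite C" "q \<in> fun_space.span C" "\<forall>h\<in>C. (\<lambda>A. h (g ** A)) \<in> fun_space.span C" by blast
  have mono: "fun_space.span B \<subseteq> fun_space.span (B \<union> C)" "fun_space.span C \<subseteq> fun_space.span (B \<union> C)"
    by (intro fun_space.span_mono; simp)+
  have "p + q \<in> fun_space.span (B \<union> C)" using B C mono by (intro fun_space.span_add) auto
  then show ?case using B C mono by (intro exI[of _ "B \<union> C"]) (auto simp: plus_fun_def)
next
  case (mult p q)
  then obtain B C where B: "finite B" "p \<in> fun_space.span B" "\<forall>h\<in>B. (\<lambda>A. h (g ** A)) \<in> fun_space.span B"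
    and C: "finite C" "q \<in> fun_space.span C" "\<forall>h\<in>C. (\<lambda>A. h (g ** A)) \<in> fun_space.span C" by blast
  let ?D = "{\<lambda>A. b A * c A |b c. b \<in> B \<and> c \<in> C}"
  have "?D = (\<lambda>(b, c) A. b A * c A) ` (B \<times> C)" by auto
  then have "finite ?D" using B C by simp
  then show ?case
    using span_pointwise_products[OF B(2) C(2)] B(3) C(3)
    by (intro exI[of _ ?D]) (auto intro: span_pointwise_products)
qed

lemma linear_relation_in_finite_span:
  assumes B: "finite B" and v: "\<And>k::nat. v k \<in> fun_space.span B"
  obtains c N s where "(\<Sum>k\<le>N. (\<lambda>A. c k * v k A)) = (0::'a \<Rightarrow> complex)" "s \<le> N" "c s \<noteq> (0::complex)"
    "\<And>k. k < s \<Longrightarrow> c k = 0"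
proof -
  let ?N = "card B"
  have "\<exists>c. (\<Sum>k\<le>?N. (\<lambda>A. c k * v k A)) = (0::'a \<Rightarrow> complex) \<and> (\<exists>k\<le>?N. c k \<noteq> 0)"
  proof (cases "inj_on v {..?N}")
    case True
    have "\<not> fun_space.independent (v ` {..?N})"
    proof
      assume "fun_space.independent (v ` {..?N})"
      then have "card (v ` {..?N}) \<le> ?N"
        using fun_space.independent_span_bound[OF B] v by blast
      then show False using True by (simp add: card_image)
    qed
    then obtain u w where u: "(\<Sum>w\<in>v ` {..?N}. (\<lambda>A. u w * w A)) = 0" "w \<in> v ` {..?N}" "u w \<noteq> 0"
      by (auto simp: fun_space.dependent_finite)
    then show ?thesis
      using True by (intro exI[of _ "u \<circ> v"]) (auto simp: sum.reindex)
  next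
    case False
    then obtain i j where ij: "i \<le> ?N" "j \<le> ?N" "i \<noteq> j" "v i = v j" by (auto simp: inj_on_def)
    \<comment> \<open>Two equal vectors give the relation \<open>v i - v j = 0\<close>.\<close>
    let ?c = "\<lambda>k. (if k = i then 1 else 0) - (if k = j then 1 else (0::complex))"
    have "(\<Sum>k\<le>?N. (\<lambda>A. ?c k * v k A)) = 0"
      using ij by (auto simp: fun_eq_iff sum_fun_apply left_diff_distrib sum_subtractf if_distrib[of "\<lambda>x. x * _"] cong: if_cong)
    then show ?thesis using ij by (intro exI[of _ ?c]) auto
  qed
  then obtain c k where c: "(\<Sum>k\<le>?N. (\<lambda>A. c k * v k A)) = 0" "k \<le> ?N" "c k \<noteq> 0" by blast
  define s where "s = (LEAST k. c k \<noteq> 0)"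
  have "c s \<noteq> 0" unfolding s_def by (rule LeastI) (rule c)
  moreover have "s \<le> ?N" unfolding s_def using Least_le[of "\<lambda>k. c k \<noteq> 0"] c by (meson le_trans)
  moreover have "\<And>k. k < s \<Longrightarrow> c k = 0" unfolding s_def using not_less_Least by blast
  ultimately show thesis using that c(1) by blast
qed

text \<open>Let \<open>f\<close> be one of the equations of \<open>M\<close>. The functions \<open>A \<mapsto> f (g\<^sup>k A)\<close> lie in a
finite-dimensional space, so they satisfy a linear relation; let \<open>s\<close> be the lowest exponent in it.
Evaluated at \<open>A = h\<^sup>s\<^sup>+\<^sup>1\<close> with \<open>h = g\<^sup>-\<^sup>1\<close>, the terms with \<open>k > s\<close> become values of \<open>f\<close> at
nonnegative powers of \<open>g\<close> and vanish, and what remains is a nonzero multiple of \<open>f h\<close>.\<close>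

lemma units_closed_under_inverse:
  assumes M: "algebraic_submonoid M" and g: "g \<in> M" and inv: "g ** h = mat 1" "h ** g = mat 1"
  shows "h \<in> M"
proof -
  have mon: "mat 1 \<in> M" "\<And>a b. a \<in> M \<Longrightarrow> b \<in> M \<Longrightarrow> a ** b \<in> M"
    using M by (auto simp: algebraic_submonoid_def matrix_submonoid_def)
  obtain P where P: "\<forall>p\<in>P. matrix_polynomial p" "M = {A. \<forall>p\<in>P. p A = 0}"
    using M unfolding algebraic_submonoid_def algebraic_set_def by blast
  have pow: "((**) g ^^ k) (mat 1) \<in> M" for k by (induction k) (auto intro: mon g)
  have cancel: "((**) g ^^ k) (((**) h ^^ k) A) = A" for k A
    by (induction k arbitrary: A) (simp_all add: funpow_swap1 matrix_mul_assoc inv)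
  have "f h = 0" if "f \<in> P" for f
  proof -
    define v where "v k = (\<lambda>A. f (((**) g ^^ k) A))" for k
    have f: "matrix_polynomial f" using P(1) that by blast
    obtain B where "finite B \<and> f \<in> fun_space.span B \<and> (\<forall>r\<in>B. (\<lambda>A. r (g ** A)) \<in> fun_space.span B)"
      using translates_span_finite_dimension[OF f, of g] by (rule exE)
    then have B: "finite B" "f \<in> fun_space.span B" "\<forall>r\<in>B. (\<lambda>A. r (g ** A)) \<in> fun_space.span B"
      by simp_all
    have translate: "(\<lambda>A. r (g ** A)) \<in> fun_space.span B" if "r \<in> fun_space.span B" for r
      using that
    proof (induction rule: fun_space.span_induct)
      case base
      show ?case
        by (auto simp: fun_space.subspace_def plus_fun_def zero_fun_def
            intro: fun_space.span_zero[unfolded zero_fun_def] fun_space.span_scale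
            dest: fun_space.span_add[of _ B, unfolded plus_fun_def])
    qed (use B in auto)
    have "v k \<in> fun_space.span B" for k
    proof (induction k)
      case 0 then show ?case using B by (simp add: v_def)
    next
      case (Suc k)
      then show ?case using translate[of "v k"] by (simp add: v_def funpow_swap1)
    qed
    then obtain c N s where c: "(\<Sum>k\<le>N. (\<lambda>A. c k * v k A)) = 0" "s \<le> N" "c s \<noteq> 0" "\<And>k. k < s \<Longrightarrow> c k = 0"
      using linear_relation_in_finite_span[OF B(1), of v] by blast
    define A where "A = ((**) h ^^ s) h"
    have "0 = (\<Sum>k\<le>N. c k * v k A)" using fun_cong[OF c(1), of A] by (simp add: sum_fun_apply)
    also have "\<dots> = (\<Sum>k\<in>{s}. c k * v k A)"
    proof (rule sum.mono_neutral_right)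
      show "\<forall>k\<in>{..N} - {s}. c k * v k A = 0"
      proof
        fix k assume k: "k \<in> {..N} - {s}"
        show "c k * v k A = 0"
        proof (cases "k < s")
          case False
          then obtain d where d: "k = d + Suc s" 
            using k that[of "k - Suc s"] by auto
          have "((**) g ^^ k) A = ((**) g ^^ d) (g ** (((**) g ^^ s) A))" by (simp add: d funpow_add funpow_swap1)
          also have "\<dots> = ((**) g ^^ d) (mat 1)" by (simp add: A_def cancel inv)
          finally show ?thesis using pow[of d] P that by (auto simp: v_def)
        qed (simp add: c)
      qed
    qed (use c in auto)
    also have "\<dots> = c s * f h" by (simp add: v_def A_def cancel)
    finally show ?thesis using c by simp
  qed
  then show ?thesis using P by blast
qed

section \<open>Green classes as double orbits of the unit group\<close>

lemma matrix_mult_distrib: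
  fixes A B C :: "complex ^ 'n ^ 'n"
  shows "(A + B) ** C = A ** C + B ** C" "(A - B) ** C = A ** C - B ** C" "A ** (B - C) = A ** B - A ** C"
  by (auto simp: matrix_matrix_mult_def vec_eq_iff algebra_simps sum.distrib sum_subtractf)

lemma green_L_I:
  assumes "\<And>x y. x \<in> M \<Longrightarrow> y \<in> M \<Longrightarrow> x ** y \<in> M" "a \<in> M" "b \<in> M" "u \<in> M" "v \<in> M" "a = u ** b" "b = v ** a"
  shows "(a, b) \<in> green_L M"
proof -
  have "x ** a = (x ** u) ** b" "x ** b = (x ** v) ** a" for x
    by (subst assms(6), simp add: matrix_mul_assoc) (subst assms(7), simp add: matrix_mul_assoc)
  then have "(\<lambda>x. x ** a) ` M = (\<lambda>x. x ** b) ` M" using assms(1,4,5) by blast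
  then show ?thesis using assms(2,3) by (simp add: green_L_def)
qed

lemma green_R_I:
  assumes "\<And>x y. x \<in> M \<Longrightarrow> y \<in> M \<Longrightarrow> x ** y \<in> M" "a \<in> M" "b \<in> M" "u \<in> M" "v \<in> M" "a = b ** u" "b = a ** v"
  shows "(a, b) \<in> green_R M"
proof -
  have "a ** x = b ** (u ** x)" "b ** x = a ** (v ** x)" for x
    by (subst assms(6), simp add: matrix_mul_assoc) (subst assms(7), simp add: matrix_mul_assoc)
  then have "(\<lambda>x. a ** x) ` M = (\<lambda>x. b ** x) ` M" using assms(1,4,5) by blast
  then show ?thesis using assms(2,3) by (simp add: green_R_def)
qed

definition unit_group :: "(complex ^ 'n ^ 'n) set \<Rightarrow> (complex ^ 'n ^ 'n) set" where
  "unit_group M = {g \<in> M. det g \<noteq> 0}"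

lemma unit_group_inverse:
  assumes "algebraic_submonoid M" "g \<in> unit_group M"
  obtains h where "h \<in> unit_group M" "g ** h = mat 1" "h ** g = mat 1"
proof -
  obtain h where h: "g ** h = mat 1" "h ** g = mat 1"
    using assms(2) by (auto simp: unit_group_def simp flip: invertible_det_nz simp: invertible_def)
  moreover have "h \<in> M" using units_closed_under_inverse[OF assms(1) _ h] assms(2) by (simp add: unit_group_def)
  moreover have "det h \<noteq> 0" using h invertible_det_nz unfolding invertible_def by blast
  ultimately show thesis using that by (simp add: unit_group_def)
qed

lemma unit_group_mult:
  assumes "algebraic_submonoid M" "g \<in> unit_group M" "h \<in> unit_group M"
  shows "g ** h \<in> unit_group M"
  using assms by (auto simp: unit_group_def algebraic_submonoid_def matrix_submonoid_def det_mul)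

text \<open>Each of the images of the unit group under \<open>F\<close> and \<open>G\<close> contains the complement, in the common image
of \<open>M\<close>, of the zeros of a polynomial that is not identically zero there. By irreducibility two such
complements intersect.\<close>

lemma same_image_unit:
  fixes F G :: "complex ^ 'n ^ 'n \<Rightarrow> complex ^ 'n ^ 'n"
  assumes M: "algebraic_submonoid M" "irreducible_set M"
    and F: "polynomial_map F" and G: "polynomial_map G" and FG: "F ` M = G ` M"
  obtains g h where "g \<in> unit_group M" "h \<in> unit_group M" "F g = G h"
proof -
  have alg: "algebraic_set M" and one: "mat 1 \<in> M" "det (mat 1 :: complex ^ 'n ^ 'n) \<noteq> 0"
    using M by (auto simp: algebraic_submonoid_def matrix_submonoid_def)
  have det: "matrix_polynomial (det :: complex ^ 'n ^ 'n \<Rightarrow> complex)"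
    by (intro matrix_polynomial_det matrix_polynomial.entry)
  obtain p where p: "matrix_polynomial p" "\<exists>m\<in>M. p (F m) \<noteq> 0"
    "\<And>m. m \<in> M \<Longrightarrow> p (F m) \<noteq> 0 \<Longrightarrow> \<exists>g\<in>M. det g \<noteq> 0 \<and> F g = F m"
    using fibre_meets_nonvanishing_locus[OF alg M(2) F det one] by blast
  obtain q where q: "matrix_polynomial q" "\<exists>m\<in>M. q (G m) \<noteq> 0"
    "\<And>m. m \<in> M \<Longrightarrow> q (G m) \<noteq> 0 \<Longrightarrow> \<exists>g\<in>M. det g \<noteq> 0 \<and> G g = G m"
    using fibre_meets_nonvanishing_locus[OF alg M(2) G det one] by blast
  have "\<exists>m\<in>M. q (F m) \<noteq> 0" using q(2) FG by (metis imageE imageI)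
  then obtain m where m: "m \<in> M" "p (F m) * q (F m) \<noteq> 0"
    using irreducible_no_zero_divisors[OF alg M(2) matrix_polynomial_compose[OF p(1) F]
        matrix_polynomial_compose[OF q(1) F]] p(2) by blast
  obtain m' where m': "m' \<in> M" "F m = G m'" using m FG by blast
  obtain g where "g \<in> M" "det g \<noteq> 0" "F g = F m" using p(3)[OF m(1)] m by auto
  moreover obtain h where "h \<in> M" "det h \<noteq> 0" "G h = G m'" using q(3)[OF m'(1)] m m' by auto
  ultimately show thesis using that m' by (simp add: unit_group_def)
qed

lemma green_R_unit:
  assumes M: "algebraic_submonoid M" "irreducible_set M" and R: "(a, b) \<in> green_R M"
  obtains g where "g \<in> unit_group M" "b = a ** g"
proof -
  obtain g h where gh: "g \<in> unit_group M" "h \<in> unit_group M" "a ** g = b ** h"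
  proof (rule same_image_unit[OF M])
    show "polynomial_map (\<lambda>x. a ** x)" "polynomial_map (\<lambda>x. b ** x)" by (intro polynomial_map_intros)+
    show "(\<lambda>x. a ** x) ` M = (\<lambda>x. b ** x) ` M" using R by (simp add: green_R_def)
  qed
  obtain k where k: "k \<in> unit_group M" "h ** k = mat 1" using unit_group_inverse[OF M(1) gh(2)] by blast
  have "a ** (g ** k) = b" using arg_cong[OF gh(3), of "\<lambda>x. x ** k"] k(2) by (simp flip: matrix_mul_assoc)
  then show thesis using that[OF unit_group_mult[OF M(1) gh(1) k(1)]] by simp
qed

lemma green_L_unit:
  assumes M: "algebraic_submonoid M" "irreducible_set M" and L: "(a, b) \<in> green_L M"
  obtains g where "g \<in> unit_group M" "b = g ** a"
proof -
  obtain g h where gh: "g \<in> unit_group M" "h \<in> unit_group M" "g ** a = h ** b"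
  proof (rule same_image_unit[OF M])
    show "polynomial_map (\<lambda>x. x ** a)" "polynomial_map (\<lambda>x. x ** b)" by (intro polynomial_map_intros)+
    show "(\<lambda>x. x ** a) ` M = (\<lambda>x. x ** b) ` M" using L by (simp add: green_L_def)
  qed
  obtain k where k: "k \<in> unit_group M" "k ** h = mat 1" using unit_group_inverse[OF M(1) gh(2)] by blast
  have "(k ** g) ** a = b" using arg_cong[OF gh(3), of "\<lambda>x. k ** x"] k(2) by (simp add: matrix_mul_assoc)
  then show thesis using that[OF unit_group_mult[OF M(1) k(1) gh(1)]] by simp
qed

lemma D_class_eq_double_orbit:
  assumes M: "algebraic_submonoid M" "irreducible_set M" and a: "a \<in> M"
  shows "D_class M a = {g ** a ** h |g h. g \<in> unit_group M \<and> h \<in> unit_group M}"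
proof (intro equalityI subsetI)
  fix b assume "b \<in> D_class M a"
  then obtain c where c: "(a, c) \<in> green_L M" "(c, b) \<in> green_R M" by (auto simp: D_class_def green_D_def)
  obtain g where "g \<in> unit_group M" "c = g ** a" using green_L_unit[OF M c(1)] .
  moreover obtain h where "h \<in> unit_group M" "b = c ** h" using green_R_unit[OF M c(2)] .
  ultimately show "b \<in> {g ** a ** h |g h. g \<in> unit_group M \<and> h \<in> unit_group M}" by blast
next
  fix b assume "b \<in> {g ** a ** h |g h. g \<in> unit_group M \<and> h \<in> unit_group M}"
  then obtain g h where gh: "g \<in> unit_group M" "h \<in> unit_group M" "b = g ** a ** h" by blast
  have mult: "x ** y \<in> M" if "x \<in> M" "y \<in> M" for x y
    using M that by (auto simp: algebraic_submonoid_def matrix_submonoid_def)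
  have in_M: "g \<in> M" "h \<in> M" using gh by (auto simp: unit_group_def)
  obtain g' where g': "g' \<in> unit_group M" "g' ** g = mat 1" using unit_group_inverse[OF M(1) gh(1)] by blast
  obtain h' where h': "h' \<in> unit_group M" "h ** h' = mat 1" using unit_group_inverse[OF M(1) gh(2)] by blast
  have "(a, g ** a) \<in> green_L M"
  proof (rule green_L_I[OF mult, where u = g' and v = g])
    show "a = g' ** (g ** a)" by (simp add: g' matrix_mul_assoc)
  qed (use g' in_M a in \<open>auto simp: unit_group_def mult\<close>)
  moreover have "(g ** a, b) \<in> green_R M"
  proof (rule green_R_I[OF mult, where u = h' and v = h])
    show "g ** a = b ** h'" by (simp add: gh h' flip: matrix_mul_assoc)
  qed (use h' in_M a gh(3) in \<open>auto simp: unit_group_def mult\<close>)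
  ultimately show "b \<in> D_class M a" by (auto simp: D_class_def green_D_def)
qed

lemma matrix_polynomial_continuous:
  assumes "matrix_polynomial p" shows "continuous_on S p"
  using assms by (induction rule: matrix_polynomial.induct) (auto intro!: continuous_intros)

section \<open>Green classes are locally algebraic\<close>

lemma cscale_mult:
  "cscale c (A ** B) = cscale c A ** B" "cscale c (A ** B) = A ** cscale c B"
  "c \<noteq> 0 \<Longrightarrow> cscale c A = cscale c B \<longleftrightarrow> A = B"
  by (auto simp: cscale_def matrix_matrix_mult_def vec_eq_iff sum_distrib_left algebra_simps)

definition adjugate :: "complex ^ 'n ^ 'n \<Rightarrow> complex ^ 'n ^ 'n" where
  "adjugate A = (\<chi> i j. det (\<chi> k l. if l = i then axis j 1 $ k else A $ k $ l))"

lemma adjugate_of_invertible: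
  assumes "A ** B = mat 1"
  shows "adjugate A = cscale (det A) B"
proof -
  have d: "det A \<noteq> 0" using assms det_mul[of A B] by auto
  have "B $ i $ j * det A = adjugate A $ i $ j" for i j
  proof -
    have "A *v (\<chi> i. B $ i $ j) = axis j 1"
      using assms by (auto simp: vec_eq_iff matrix_vector_mult_def matrix_matrix_mult_def mat_def axis_def)
    from cramer[OF d, THEN iffD1, OF this] show ?thesis
      using d by (auto simp: vec_eq_iff adjugate_def)
  qed
  then show ?thesis by (simp add: vec_eq_iff cscale_def mult.commute)
qed

lemma matrix_polynomial_if:
  "matrix_polynomial p \<Longrightarrow> matrix_polynomial q \<Longrightarrow> matrix_polynomial (\<lambda>A. if b then p A else q A)"
  by (cases b) auto

lemma polynomial_map_adjugate: "polynomial_map F \<Longrightarrow> polynomial_map (\<lambda>A. adjugate (F A))"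
  unfolding polynomial_map_def adjugate_def vec_lambda_beta
  by (intro allI matrix_polynomial_det) (auto intro!: matrix_polynomial_if matrix_polynomial.const)

lemma algebraic_set_Int_zeros:
  assumes "algebraic_set M" "polynomial_map F"
  shows "algebraic_set (M \<inter> {A. F A = 0})"
proof -
  obtain P where P: "\<forall>p\<in>P. matrix_polynomial p" "M = {A. \<forall>p\<in>P. p A = 0}"
    using assms(1) unfolding algebraic_set_def by blast
  show ?thesis
    unfolding algebraic_set_def
    by (rule exI[of _ "P \<union> (\<Union>i j. {\<lambda>A. F A $ i $ j})"])
      (use P assms(2) in \<open>auto simp: polynomial_map_def vec_eq_iff ball_Un\<close>)
qed

text \<open>The column space of \<open>q ** f\<close> is contained in that of \<open>q\<close>, and \<open>q = u ** (q ** f) ** h\<close> shows that its dimension is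
not smaller, so the two spaces agree.\<close>

lemma column_space_stability:
  fixes q f :: "complex ^ 'n ^ 'n"
  assumes "q = u ** (q ** f) ** h"
  obtains y where "q = (q ** f) ** y"
proof -
  let ?S = "range ((*v) (q ** f))" and ?T = "range ((*v) q)"
  have sub: "vec.subspace (range ((*v) (A :: complex ^ 'n ^ 'n)))" for A
    by (intro vec.linear_subspace_image matrix_vector_mul_linear_gen vec.subspace_UNIV)
  have "?S \<subseteq> ?T" by (auto simp flip: matrix_vector_mul_assoc)
  moreover have "?T \<subseteq> (*v) u ` ?S"
  proof
    fix x assume "x \<in> ?T"
    then obtain v where "x = q *v v" by blast
    then have "x = u *v ((q ** f) *v (h *v v))" using assms by (metis matrix_vector_mul_assoc)
    then show "x \<in> (*v) u ` ?S" by blast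
  qed
  then have "vec.dim ?T \<le> vec.dim ?S"
    using vec.dim_subset vec.dim_image_le[OF matrix_vector_mul_linear_gen] order_trans by blast
  ultimately have eq: "?S = ?T" by (intro vec.subspace_dim_equal sub)
  have "\<exists>v. q *v axis j 1 = (q ** f) *v v" for j using eq by blast
  then obtain v where v: "\<And>j. q *v axis j 1 = (q ** f) *v v j" by metis
  have "q = (q ** f) ** (\<chi> i j. v j $ i)"
  proof -
    have "q $ i $ j = ((q ** f) ** (\<chi> i j. v j $ i)) $ i $ j" for i j
    proof -
      have "q $ i $ j = (q *v axis j 1) $ i"
        by (simp add: matrix_vector_mult_def axis_def if_distrib cong: if_cong)
      also have "\<dots> = ((q ** f) ** (\<chi> i j. v j $ i)) $ i $ j"
        by (simp add: v) (simp add: matrix_vector_mult_def matrix_matrix_mult_def)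
      finally show ?thesis .
    qed
    then show ?thesis by (simp add: vec_eq_iff)
  qed
  then show thesis by (rule that)
qed

text \<open>Choose \<open>x\<close> with \<open>p x p = p\<close> and put \<open>f = x p\<close>, an idempotent with the same row space as \<open>p\<close>. For
\<open>q\<close> near \<open>p\<close> the matrix \<open>N q = 1 + x (q - p) f\<close> is invertible, and \<open>N q f = x q f\<close>, so \<open>p = p f\<close> is
a left multiple of \<open>q f\<close>. If in addition \<open>q\<close> is a right multiple of \<open>q f\<close>, regularity moves both
multipliers into \<open>M\<close> and gives \<open>p \<L> q f \<R> q\<close>. Conversely, elements of \<open>D\<^sub>p\<close> have the rank of \<open>p\<close>,
so \<open>column_space_stability\<close> applies to them. The only possible multiplier, up to
elements annihilated by \<open>q f\<close>, is \<open>(N q)\<^sup>-\<^sup>1 x q\<close>; clearing the determinant makes the equation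
\<open>q = q f (N q)\<^sup>-\<^sup>1 x q\<close> polynomial in \<open>q\<close>.\<close>

lemma D_class_locally_algebraic:
  fixes M :: "(complex ^ 'n ^ 'n) set"
  assumes M: "algebraic_submonoid M" "irreducible_set M" and reg: "regular_monoid M" and p: "p \<in> M"
  obtains U X where "open U" "p \<in> U" "algebraic_set X" "D_class M p \<inter> U = X \<inter> U"
proof -
  have mult: "x ** y \<in> M" if "x \<in> M" "y \<in> M" for x y
    using M that by (auto simp: algebraic_submonoid_def matrix_submonoid_def)
  have alg: "algebraic_set M" using M by (simp add: algebraic_submonoid_def)
  obtain x where x: "x \<in> M" "p ** x ** p = p" using reg p unfolding regular_monoid_def by blast
  define f where "f = x ** p"
  have f: "f \<in> M" "f ** f = f" "p ** f = p" "x ** p ** f = f"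
  proof -
    show "f \<in> M" by (simp add: f_def mult x p)
    show "f ** f = f" "p ** f = p" "x ** p ** f = f" using x(2) by (metis f_def matrix_mul_assoc)+
  qed
  define N where "N q = mat 1 + x ** (q - p) ** f" for q
  have polyN: "polynomial_map N" unfolding N_def by (intro polynomial_map_intros)
  have polydet: "matrix_polynomial (\<lambda>q. det (N q))"
    using polyN by (intro matrix_polynomial_det) (simp add: polynomial_map_def)
  define U where "U = {q. det (N q) \<noteq> 0}"
  define E where "E q = cscale (det (N q)) q - q ** f ** adjugate (N q) ** x ** q" for q
  define X where "X = M \<inter> {q. E q = 0}"
  have "open U"
    using matrix_polynomial_continuous[OF polydet] unfolding U_def
    by (intro open_Collect_neq continuous_on_const)
  moreover have "p \<in> U" by (simp add: U_def N_def)
  moreover have "algebraic_set X"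
  proof -
    have "polynomial_map (\<lambda>q. cscale (det (N q)) q)"
      using polydet by (auto simp: polynomial_map_def cscale_def intro: matrix_polynomial.intros)
    then have "polynomial_map E"
      unfolding E_def by (intro polynomial_map_intros polynomial_map_adjugate polyN)
    then show ?thesis unfolding X_def by (intro algebraic_set_Int_zeros alg)
  qed
  moreover have "D_class M p \<inter> U = X \<inter> U"
  proof -
    have "q \<in> D_class M p \<longleftrightarrow> q \<in> X" if q: "q \<in> U" for q
    proof -
      have "det (N q) \<noteq> 0" using q by (simp add: U_def)
      then obtain K where K: "N q ** K = mat 1" "K ** N q = mat 1"
        by (auto simp flip: invertible_det_nz simp: invertible_def)
      have "N q ** f = x ** q ** f"
      proof -
        have "N q ** f = f + x ** (q - p) ** (f ** f)"
          by (simp add: N_def matrix_mult_distrib matrix_mul_assoc)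
        also have "\<dots> = f + (x ** q ** f - x ** p ** f)"
          by (simp add: f matrix_mult_distrib)
        finally show ?thesis by (simp add: f)
      qed
      then have Kf: "K ** x ** q ** f = f" using K(2) by (metis matrix_mul_assoc matrix_mul_lid)
      then have z: "p = (p ** K ** x) ** (q ** f)" using f(3) by (metis matrix_mul_assoc)
      have "adjugate (N q) = cscale (det (N q)) K" by (rule adjugate_of_invertible) (rule K)
      then have "E q = cscale (det (N q)) q - cscale (det (N q)) (q ** f ** K ** x ** q)"
        by (simp add: E_def flip: cscale_mult)
      then have E: "E q = 0 \<longleftrightarrow> q = q ** f ** K ** x ** q"
        using cscale_mult(3)[OF \<open>det (N q) \<noteq> 0\<close>] by auto
      show ?thesis
      proof
        assume "q \<in> X"
        then have qM: "q \<in> M" and y: "q = (q ** f) ** (K ** x ** q)"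
          using E by (auto simp: X_def matrix_mul_assoc)
        have qf: "q ** f \<in> M" by (intro mult qM f)
        then obtain w where w: "w \<in> M" "(q ** f) ** w ** (q ** f) = q ** f" using reg unfolding regular_monoid_def by blast
        have "(p, q ** f) \<in> green_L M"
        proof (rule green_L_I[OF mult, where u = "p ** w" and v = "q ** x"])
          show "p = p ** w ** (q ** f)" using z w(2) by (metis matrix_mul_assoc)
          show "q ** f = q ** x ** p" by (simp add: f_def matrix_mul_assoc)
        qed (use p qf w x qM in \<open>auto intro: mult\<close>)
        moreover have "(q ** f, q) \<in> green_R M"
        proof (rule green_R_I[OF mult, where u = f and v = "w ** q"])
          show "q = q ** f ** (w ** q)" using y w(2) by (metis matrix_mul_assoc)
        qed (use qf w f qM in \<open>auto intro: mult\<close>)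
        ultimately show "q \<in> D_class M p" by (auto simp: D_class_def green_D_def)
      next
        assume "q \<in> D_class M p"
        then obtain g h where gh: "g \<in> unit_group M" "h \<in> unit_group M" "q = g ** p ** h"
          unfolding D_class_eq_double_orbit[OF M p] by blast
        then have qM: "q \<in> M" using p by (auto simp: unit_group_def intro!: mult)
        have "q = (g ** (p ** K ** x)) ** (q ** f) ** h" using gh(3) z by (metis matrix_mul_assoc)
        then obtain y where y: "q = (q ** f) ** y" by (rule column_space_stability)
        have "q ** f ** K ** x ** q = q ** f ** (K ** x ** q ** f) ** y" by (metis y matrix_mul_assoc)
        also have "\<dots> = q ** (f ** f) ** y" by (simp add: Kf matrix_mul_assoc)
        also have "\<dots> = q" by (simp add: f) (rule y[symmetric])
        finally show "q \<in> X" using E qM by (simp add: X_def)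
      qed
    qed
    then show ?thesis by blast
  qed
  ultimately show thesis using that by blast
qed

section \<open>Holomorphic charts from polynomials with independent differentials\<close>

abbreviation entry_at :: "'n \<times> 'n \<Rightarrow> complex ^ 'n ^ 'n \<Rightarrow> complex" where
  "entry_at s A \<equiv> A $ fst s $ snd s"

lemma matrix_polynomial_has_derivative:
  assumes "matrix_polynomial p"
  shows "\<exists>d. (\<forall>s. matrix_polynomial (d s)) \<and>
    (\<forall>x. (p has_derivative (\<lambda>h. \<Sum>s\<in>UNIV. d s x * entry_at s h)) (at x))"
  using assms
proof (induction rule: matrix_polynomial.induct)
  case (const c)
  show ?case
    by (intro exI[of _ "\<lambda>s A. 0"]) (auto intro: matrix_polynomial.const)
next
  case (entry i j)
  let ?d = "\<lambda>s (A::complex^'a^'a). if s = (i, j) then 1 else (0::complex)"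
  have "((\<lambda>A. A $ i $ j) has_derivative (\<lambda>h. h $ i $ j)) (at x)" for x :: "complex ^ 'a ^ 'a"
    by (intro bounded_linear_imp_has_derivative bounded_linear_compose[OF bounded_linear_vec_nth bounded_linear_vec_nth])
  moreover have "(\<Sum>s\<in>UNIV. ?d s x * entry_at s h) = h $ i $ j" for x h
    by (simp add: if_distrib[of "\<lambda>z. z * _"] cong: if_cong)
  ultimately show ?case
    by (intro exI[of _ ?d]) (auto intro: matrix_polynomial.const)
next
  case (add p q)
  then obtain d e where
    d: "\<And>s. matrix_polynomial (d s)" "\<And>x. (p has_derivative (\<lambda>h. \<Sum>s\<in>UNIV. d s x * entry_at s h)) (at x)" and
    e: "\<And>s. matrix_polynomial (e s)" "\<And>x. (q has_derivative (\<lambda>h. \<Sum>s\<in>UNIV. e s x * entry_at s h)) (at x)"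
    by blast
  have "((\<lambda>A. p A + q A) has_derivative (\<lambda>h. \<Sum>s\<in>UNIV. (d s x + e s x) * entry_at s h)) (at x)" for x
    using has_derivative_add[OF d(2) e(2)] by (simp add: sum.distrib distrib_right)
  then show ?case
    using d(1) e(1) by (intro exI[of _ "\<lambda>s A. d s A + e s A"]) (auto intro: matrix_polynomial.add)
next
  case (mult p q)
  then obtain d e where
    d: "\<And>s. matrix_polynomial (d s)" "\<And>x. (p has_derivative (\<lambda>h. \<Sum>s\<in>UNIV. d s x * entry_at s h)) (at x)" and
    e: "\<And>s. matrix_polynomial (e s)" "\<And>x. (q has_derivative (\<lambda>h. \<Sum>s\<in>UNIV. e s x * entry_at s h)) (at x)"
    by blast
  have "((\<lambda>A. p A * q A) has_derivative (\<lambda>h. \<Sum>s\<in>UNIV. (p x * e s x + d s x * q x) * entry_at s h)) (at x)" for x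
    using has_derivative_mult[OF d(2)[of x] e(2)[of x]]
    by (simp add: sum.distrib sum_distrib_left sum_distrib_right algebra_simps)
  then show ?case
    using d(1) e(1) mult.hyps
    by (intro exI[of _ "\<lambda>s A. p A * e s A + d s A * q A"] conjI allI matrix_polynomial.add matrix_polynomial.mult)
      simp_all
qed

text \<open>The choice is made once for the whole family of partial derivatives, so that it consists of
polynomials; the derivative itself determines their values.\<close>

definition partial_deriv :: "'n \<times> 'n \<Rightarrow> (complex ^ 'n ^ 'n \<Rightarrow> complex) \<Rightarrow> complex ^ 'n ^ 'n \<Rightarrow> complex" where
  "partial_deriv s p = (SOME d. (\<forall>s. matrix_polynomial (d s)) \<and>
    (\<forall>x. (p has_derivative (\<lambda>h. \<Sum>s\<in>UNIV. d s x * entry_at s h)) (at x))) s"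

lemma partial_deriv:
  assumes "matrix_polynomial p"
  shows "matrix_polynomial (partial_deriv s p)"
    "(p has_derivative (\<lambda>h. \<Sum>s\<in>UNIV. partial_deriv s p x * entry_at s h)) (at x)"
proof -
  define d where "d = (SOME d. (\<forall>s. matrix_polynomial (d s)) \<and>
    (\<forall>x. (p has_derivative (\<lambda>h. \<Sum>s\<in>UNIV. d s x * entry_at s h)) (at x)))"
  have "(\<forall>s. matrix_polynomial (d s)) \<and>
    (\<forall>x. (p has_derivative (\<lambda>h. \<Sum>s\<in>UNIV. d s x * entry_at s h)) (at x))"
    using someI_ex[OF matrix_polynomial_has_derivative[OF assms]] unfolding d_def .
  then have d: "matrix_polynomial (d s)"
    "(p has_derivative (\<lambda>h. \<Sum>s\<in>UNIV. d s x * entry_at s h)) (at x)" by blast+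
  have "partial_deriv s p = d s" for s unfolding partial_deriv_def d_def by (rule refl)
  then show "matrix_polynomial (partial_deriv s p)"
    "(p has_derivative (\<lambda>h. \<Sum>s\<in>UNIV. partial_deriv s p x * entry_at s h)) (at x)"
    using d by simp_all
qed

lemma has_derivative_vec_lambda:
  fixes f :: "'i::finite \<Rightarrow> 'a::real_normed_vector \<Rightarrow> 'b::euclidean_space"
  assumes "\<And>i. (f i has_derivative f' i) (at x)"
  shows "((\<lambda>x. \<chi> i. f i x) has_derivative (\<lambda>h. \<chi> i. f' i h)) (at x)"
  by (subst has_derivative_componentwise_within)
    (auto simp: Basis_vec_def inner_axis intro!: has_derivative_inner_left assms)

text \<open>The \<open>\<complex>\<close>-linear endomorphism of the space of matrices whose matrix in the basis of matrix units is \<open>B\<close>.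
This indexing by pairs makes determinants and Cramer's rule available for Jacobians.\<close>

definition matrix_endo :: "complex ^ ('n \<times> 'n) ^ ('n \<times> 'n) \<Rightarrow> complex ^ 'n ^ 'n \<Rightarrow> complex ^ 'n ^ 'n" where
  "matrix_endo B h = (\<chi> i j. \<Sum>t\<in>UNIV. B $ (i, j) $ t * entry_at t h)"

lemma matrix_endo_entry: "entry_at s (matrix_endo B h) = (\<Sum>t\<in>UNIV. B $ s $ t * entry_at t h)"
  by (simp add: matrix_endo_def)

lemma matrix_eq_entries: "A = B \<longleftrightarrow> (\<forall>s. entry_at s A = entry_at s B)"
  by (auto simp: vec_eq_iff)

lemma matrix_endo_mult: "matrix_endo (B ** C) h = matrix_endo B (matrix_endo C h)"
proof -
  have "entry_at s (matrix_endo (B ** C) h) = entry_at s (matrix_endo B (matrix_endo C h))" for s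
  proof -
    have "(\<Sum>t\<in>UNIV. (\<Sum>k\<in>UNIV. B $ s $ k * C $ k $ t) * entry_at t h)
        = (\<Sum>t\<in>UNIV. \<Sum>k\<in>UNIV. B $ s $ k * (C $ k $ t * entry_at t h))"
      by (simp add: sum_distrib_right mult.assoc)
    also have "\<dots> = (\<Sum>k\<in>UNIV. \<Sum>t\<in>UNIV. B $ s $ k * (C $ k $ t * entry_at t h))"
      by (rule sum.swap)
    finally show ?thesis
      unfolding matrix_endo_entry by (simp add: matrix_matrix_mult_def sum_distrib_left)
  qed
  then show ?thesis by (simp add: matrix_eq_entries)
qed

lemma matrix_endo_one: "matrix_endo (mat 1) h = h"
  by (simp add: matrix_eq_entries matrix_endo_entry mat_def if_distrib[of "\<lambda>z. z * _"] cong: if_cong)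

lemma matrix_endo_cscale: "matrix_endo B (cscale c h) = cscale c (matrix_endo B h)"
  by (simp add: matrix_endo_def cscale_def vec_eq_iff sum_distrib_left algebra_simps)

lemma bounded_linear_matrix_endo: "bounded_linear (matrix_endo B)"
proof (rule linear_conv_bounded_linear[THEN iffD1], rule linearI)
  show "matrix_endo B (x + y) = matrix_endo B x + matrix_endo B y" for x y
    by (simp add: matrix_endo_def vec_eq_iff sum.distrib algebra_simps)
  show "matrix_endo B (r *\<^sub>R x) = r *\<^sub>R matrix_endo B x" for r x
    by (simp add: matrix_endo_def vec_eq_iff scaleR_sum_right)
qed

text \<open>The coordinates in \<open>S\<close> are replaced by the functions \<open>f\<close> and the others are kept. Every family of
functions with independent differentials at a point can be completed to local coordinates in this way.\<close>

definition partial_coords :: "('n \<times> 'n) set \<Rightarrow> ('n \<times> 'n \<Rightarrow> complex ^ 'n ^ 'n \<Rightarrow> complex) \<Rightarrow>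
    complex ^ 'n ^ 'n \<Rightarrow> complex ^ 'n ^ 'n" where
  "partial_coords S f x = (\<chi> i j. if (i, j) \<in> S then f (i, j) x else x $ i $ j)"

definition partial_jacobian :: "('n \<times> 'n) set \<Rightarrow> ('n \<times> 'n \<Rightarrow> complex ^ 'n ^ 'n \<Rightarrow> complex) \<Rightarrow>
    complex ^ 'n ^ 'n \<Rightarrow> complex ^ ('n \<times> 'n) ^ ('n \<times> 'n)" where
  "partial_jacobian S f x = (\<chi> s t. if s \<in> S then partial_deriv t (f s) x else if t = s then 1 else 0)"

lemma partial_coords_has_derivative:
  assumes f: "\<And>s. s \<in> S \<Longrightarrow> matrix_polynomial (f s)"
  shows "(partial_coords S f has_derivative matrix_endo (partial_jacobian S f x)) (at x)"
proof -
  have "((\<lambda>x. if (i, j) \<in> S then f (i, j) x else x $ i $ j) has_derivative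
    (\<lambda>h. \<Sum>t\<in>UNIV. partial_jacobian S f x $ (i, j) $ t * entry_at t h)) (at x)" for i j
  proof (cases "(i, j) \<in> S")
    case True
    then show ?thesis using partial_deriv(2)[OF f] by (simp add: partial_jacobian_def)
  next
    case False
    have "((\<lambda>A. A $ i $ j) has_derivative (\<lambda>h. h $ i $ j)) (at x)"
      by (intro bounded_linear_imp_has_derivative bounded_linear_compose[OF bounded_linear_vec_nth bounded_linear_vec_nth])
    then show ?thesis using False
      by (simp add: partial_jacobian_def if_distrib[of "\<lambda>z. z * _"] cong: if_cong)
  qed
  then show ?thesis
    unfolding partial_coords_def[abs_def] matrix_endo_def[abs_def]
    by (intro has_derivative_vec_lambda)
qed

lemma matrix_polynomial_partial_jacobian:
  assumes "\<And>s. s \<in> S \<Longrightarrow> matrix_polynomial (f s)"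
  shows "matrix_polynomial (\<lambda>x. partial_jacobian S f x $ s $ t)"
  using partial_deriv(1)[OF assms, of s t]
  by (cases "s \<in> S") (simp_all add: partial_jacobian_def matrix_polynomial.const)

lemma holomorphic_inverse_function:
  fixes S :: "('n::finite \<times> 'n) set"
  assumes f: "\<And>s. s \<in> S \<Longrightarrow> matrix_polynomial (f s)"
    and q: "det (partial_jacobian S f q) \<noteq> 0" and W: "open W" "q \<in> W"
  obtains U e \<psi> where "open U" "q \<in> U" "U \<subseteq> W" "e > 0"
    "homeomorphism U (ball (partial_coords S f q) e) (partial_coords S f) \<psi>"
    "\<And>x. x \<in> U \<Longrightarrow> det (partial_jacobian S f x) \<noteq> 0"
    "\<And>y K. y \<in> ball (partial_coords S f q) e \<Longrightarrow> partial_jacobian S f (\<psi> y) ** K = mat 1 \<Longrightarrow>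
       (\<psi> has_derivative matrix_endo K) (at y)"
proof -
  let ?\<Phi> = "partial_coords S f" and ?J = "partial_jacobian S f"
  define D where "D x = Blinfun (matrix_endo (?J x))" for x
  have D: "blinfun_apply (D x) = matrix_endo (?J x)" for x
    unfolding D_def by (intro bounded_linear_Blinfun_apply bounded_linear_matrix_endo)
  define W' where "W' = W \<inter> {x. det (?J x) \<noteq> 0}"
  have "matrix_polynomial (\<lambda>x. det (?J x))"
    by (intro matrix_polynomial_det matrix_polynomial_partial_jacobian f)
  then have W': "open W'" "q \<in> W'"
    using W q unfolding W'_def
    by (auto intro!: open_Int open_Collect_neq matrix_polynomial_continuous matrix_polynomial.const)
  have contD: "continuous_on W' D"
  proof (rule continuous_on_blinfun_componentwise)
    fix h :: "complex ^ 'n ^ 'n"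
    show "continuous_on W' (\<lambda>x. blinfun_apply (D x) h)"
      unfolding D matrix_endo_def
      by (intro continuous_intros matrix_polynomial_continuous matrix_polynomial_partial_jacobian f)
  qed
  obtain K where K: "K ** ?J q = mat 1" using q by (auto simp flip: invertible_det_nz simp: invertible_def)
  have inv: "Blinfun (matrix_endo K) o\<^sub>L D q = id_blinfun"
    by (rule blinfun_eqI)
      (simp add: D bounded_linear_Blinfun_apply[OF bounded_linear_matrix_endo] K matrix_endo_one flip: matrix_endo_mult)
  have der: "(?\<Phi> has_derivative blinfun_apply (D x)) (at x)" for x
    unfolding D by (rule partial_coords_has_derivative) (rule f)
  obtain U' V \<psi> g' where U': "open U'" "U' \<subseteq> W'" "q \<in> U'" and V: "open V" "?\<Phi> q \<in> V" "homeomorphism U' V ?\<Phi> \<psi>"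
    and \<psi>: "\<And>y. y \<in> V \<Longrightarrow> (\<psi> has_derivative g' y) (at y)" "\<And>y. y \<in> V \<Longrightarrow> g' y = inv (blinfun_apply (D (\<psi> y)))"
    using inverse_function_theorem[OF W'(1) der contD W'(2) inv] by metis
  obtain e where e: "e > 0" "ball (?\<Phi> q) e \<subseteq> V" using V open_contains_ball by blast
  define U where "U = U' \<inter> ?\<Phi> -` ball (?\<Phi> q) e"
  have cont: "continuous_on U' ?\<Phi>"
    using der by (meson continuous_at_imp_continuous_on has_derivative_continuous)
  have "open U" unfolding U_def by (rule continuous_open_preimage[OF cont U'(1)]) simp
  moreover have "q \<in> U" using U' e by (simp add: U_def)
  moreover have "U \<subseteq> W" using U' by (auto simp: U_def W'_def)
  moreover have "homeomorphism U (ball (?\<Phi> q) e) ?\<Phi> \<psi>"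
  proof (rule homeomorphism_of_subsets[OF V(3), where T'' = "{}"])
    show "?\<Phi> ` U = ball (?\<Phi> q) e"
    proof
      show "ball (?\<Phi> q) e \<subseteq> ?\<Phi> ` U"
      proof
        fix y assume y: "y \<in> ball (?\<Phi> q) e"
        then have "y \<in> ?\<Phi> ` U'" using e homeomorphism_image1[OF V(3)] by blast
        then show "y \<in> ?\<Phi> ` U" using y by (auto simp: U_def)
      qed
    qed (auto simp: U_def)
  qed (auto simp: U_def)
  moreover have "det (?J x) \<noteq> 0" if "x \<in> U" for x using that U' by (auto simp: U_def W'_def)
  moreover have "(\<psi> has_derivative matrix_endo K) (at y)"
    if y: "y \<in> ball (?\<Phi> q) e" and K: "?J (\<psi> y) ** K = mat 1" for y K
  proof -
    have "K ** ?J (\<psi> y) = mat 1" using K matrix_left_right_inverse by blast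
    then have "inv (matrix_endo (?J (\<psi> y))) = matrix_endo K"
      using K by (intro inv_unique_comp) (auto simp: fun_eq_iff matrix_endo_one simp flip: matrix_endo_mult)
    then show ?thesis using \<psi>(1)[of y] \<psi>(2)[of y] y e D by auto
  qed
  ultimately show thesis using that e(1) by blast
qed

lemma matrix_holomorphic_on_partial_coords:
  assumes "\<And>s. s \<in> S \<Longrightarrow> matrix_polynomial (f s)"
  shows "matrix_holomorphic_on (partial_coords S f) U"
  unfolding matrix_holomorphic_on_def
proof
  fix x assume "x \<in> U"
  show "\<exists>f'. (partial_coords S f has_derivative f') (at x) \<and> (\<forall>c h. f' (cscale c h) = cscale c (f' h))"
    using partial_coords_has_derivative[OF assms] by (intro exI[of _ "matrix_endo (partial_jacobian S f x)"])
      (simp add: matrix_endo_cscale)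
qed

text \<open>Cramer's rule: the coordinates of the row vector \<open>w\<close> in the basis formed by the rows of \<open>J\<close>.\<close>

lemma gradient_times_inverse_jacobian:
  fixes J K :: "complex ^ 'm ^ 'm"
  assumes K: "K ** J = mat 1"
  shows "det (\<chi> s t. if s = k then w t else J $ s $ t) = (\<Sum>t\<in>UNIV. w t * K $ t $ k) * det J"
proof -
  define x where "x = (\<chi> s. \<Sum>t\<in>UNIV. w t * K $ t $ s)"
  have "(\<Sum>i\<in>UNIV. x $ i *s row i J) $ t = w t" for t
  proof -
    have "(\<Sum>i\<in>UNIV. x $ i *s row i J) $ t = (\<Sum>i\<in>UNIV. \<Sum>u\<in>UNIV. w u * (K $ u $ i * J $ i $ t))"
      by (simp add: x_def row_def sum_distrib_right mult.assoc)
    also have "\<dots> = (\<Sum>u\<in>UNIV. w u * (K ** J) $ u $ t)"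
      unfolding matrix_matrix_mult_def by (subst sum.swap) (simp add: sum_distrib_left)
    also have "\<dots> = w t" by (simp add: K mat_def if_distrib[of "\<lambda>z. _ * z"] cong: if_cong)
    finally show ?thesis .
  qed
  then have "(\<chi> s. if s = k then (\<Sum>i\<in>UNIV. x $ i *s row i J) else row s J)
      = (\<chi> s t. if s = k then w t else J $ s $ t)"
    by (simp add: vec_eq_iff row_def)
  then show ?thesis using cramer_lemma_transpose[of k x J] by (simp add: x_def)
qed

text \<open>If \<open>J\<close> is the Jacobian of a chart with inverse \<open>\<psi>\<close>, the derivative of \<open>h\<close> in the chart's \<open>s\<close>-th
coordinate direction is, up to the factor \<open>det J\<close>, the determinant of \<open>J\<close> with row \<open>s\<close> replaced by
the gradient of \<open>h\<close>. This determinant is again a polynomial when \<open>h\<close> and the chart are.\<close>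

lemma deriv_along_chart_line:
  fixes h :: "complex ^ 'n ^ 'n \<Rightarrow> complex"
  assumes h: "matrix_polynomial h"
    and \<psi>: "(\<psi> has_derivative matrix_endo K) (at (y + cscale z v))"
    and K: "K ** J = mat 1"
  shows "((\<lambda>z. h (\<psi> (y + cscale z v))) has_field_derivative
    (\<Sum>s\<in>UNIV. entry_at s v *
      det (\<chi> s' t. if s' = s then partial_deriv t h (\<psi> (y + cscale z v)) else J $ s' $ t)) / det J) (at z)"
proof -
  let ?w = "\<lambda>t. partial_deriv t h (\<psi> (y + cscale z v))"
  have J0: "det J \<noteq> 0" using K det_mul[of K J] by auto
  have line: "((\<lambda>z. y + cscale z v) has_derivative (\<lambda>c. cscale c v)) (at z)"
  proof -
    have "bounded_linear (\<lambda>c. cscale c v)"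
      by (rule linear_conv_bounded_linear[THEN iffD1], rule linearI)
        (simp_all add: cscale_def vec_eq_iff algebra_simps)
    then show ?thesis by (auto intro!: derivative_eq_intros bounded_linear_imp_has_derivative)
  qed
  have "((\<lambda>z. h (\<psi> (y + cscale z v))) has_derivative
    (\<lambda>c. \<Sum>t\<in>UNIV. ?w t * entry_at t (matrix_endo K (cscale c v)))) (at z)"
    using has_derivative_compose[OF has_derivative_compose[OF line \<psi>] partial_deriv(2)[OF h]] by simp
  moreover have "(\<Sum>t\<in>UNIV. ?w t * entry_at t (matrix_endo K (cscale c v)))
      = c * ((\<Sum>s\<in>UNIV. entry_at s v * det (\<chi> s' t. if s' = s then ?w t else J $ s' $ t)) / det J)" for c
  proof -
    have "(\<Sum>s\<in>UNIV. entry_at s v * det (\<chi> s' t. if s' = s then ?w t else J $ s' $ t))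
        = (\<Sum>s\<in>UNIV. entry_at s v * (\<Sum>t\<in>UNIV. ?w t * K $ t $ s)) * det J"
      unfolding gradient_times_inverse_jacobian[OF K] by (simp add: sum_distrib_right mult.assoc)
    also have "(\<Sum>s\<in>UNIV. entry_at s v * (\<Sum>t\<in>UNIV. ?w t * K $ t $ s))
        = (\<Sum>t\<in>UNIV. ?w t * (\<Sum>s\<in>UNIV. K $ t $ s * entry_at s v))"
      unfolding sum_distrib_left by (subst sum.swap) (simp add: mult_ac)
    finally show ?thesis
      using J0 by (simp add: matrix_endo_cscale matrix_endo_entry[symmetric] sum_distrib_left)
        (simp add: cscale_def mult_ac)
  qed
  ultimately show ?thesis
    unfolding has_field_derivative_def by (elim has_derivative_eq_rhs) (simp add: fun_eq_iff mult.commute)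
qed

section \<open>Smooth points of algebraic sets\<close>

text \<open>The functions \<open>f s\<close> vanish on \<open>X\<close> near \<open>q\<close>, and their differentials at \<open>q\<close>
together with those of the coordinates outside \<open>S\<close> are linearly independent.\<close>

definition local_equations where
  "local_equations X W S f U q \<longleftrightarrow>
     (\<forall>s\<in>S. matrix_polynomial (f s) \<and> (\<forall>A\<in>X \<inter> U. f s A = 0)) \<and>
     open U \<and> U \<subseteq> W \<and> q \<in> X \<inter> U \<and> det (partial_jacobian S f q) \<noteq> 0"

text \<open>Differentiating \<open>u h\<close> stays, up to the factor \<open>r\<close>, in a family of functions that all vanish at \<open>t0\<close>.
By Leibniz' rule all derivatives of \<open>u h\<close> vanish there, and the identity theorem applies.\<close>

lemma analytic_vanishing_by_recursion:
  fixes u :: "'h \<Rightarrow> complex \<Rightarrow> complex"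
  assumes T: "open T" "connected T" "t0 \<in> T" "t1 \<in> T"
    and hol: "\<And>h. h \<in> H \<Longrightarrow> u h holomorphic_on T" and r: "r holomorphic_on T"
    and zero: "\<And>h. h \<in> H \<Longrightarrow> u h t0 = 0"
    and der: "\<And>h. h \<in> H \<Longrightarrow> d h \<in> H \<and> (\<forall>t\<in>T. deriv (u h) t = u (d h) t * r t)"
    and h: "h \<in> H"
  shows "u h t1 = 0"
proof -
  have "(deriv ^^ n) (u h) t0 = 0" if "h \<in> H" for n h
    using that
  proof (induction n arbitrary: h rule: less_induct)
    case (less n)
    show ?case
    proof (cases n)
      case 0
      then show ?thesis using zero less.prems by simp
    next
      case (Suc m)
      have d: "d h \<in> H" "\<And>t. t \<in> T \<Longrightarrow> deriv (u h) t = u (d h) t * r t" using der[OF less.prems] by auto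
      have "(deriv ^^ n) (u h) t0 = (deriv ^^ m) (deriv (u h)) t0"
        by (simp add: Suc funpow_swap1)
      also have "\<dots> = (deriv ^^ m) (\<lambda>t. u (d h) t * r t) t0"
        by (rule higher_deriv_transform_within_open[OF _ _ T(1,3)])
          (use d hol less.prems r T in \<open>auto intro!: holomorphic_intros\<close>)
      also have "\<dots> = (\<Sum>i=0..m. of_nat (m choose i) * (deriv ^^ i) (u (d h)) t0 * (deriv ^^ (m - i)) r t0)"
        by (rule higher_deriv_mult[OF hol[OF d(1)] r T(1,3)])
      also have "\<dots> = 0" using less.IH[OF _ d(1)] Suc by (intro sum.neutral) auto
      finally show ?thesis .
    qed
  qed
  then show ?thesis
    using holomorphic_fun_eq_0_on_connected[OF hol[OF h] T(1,2) _ T(3,4)] h by blast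
qed

lemma cscale_simps [simp]: "cscale 0 A = 0" "cscale 1 A = A"
  by (simp_all add: cscale_def vec_eq_iff)

text \<open>Choose local equations \<open>f\<close> with \<open>S\<close> as large as possible, and let \<open>U\<close> be the domain of the chart
\<open>partial_coords S f\<close>. If a polynomial \<open>h\<close> vanishes on \<open>X \<inter> U\<close>, so does its derivative \<open>D s h\<close>
in a coordinate direction \<open>s\<close> outside \<open>S\<close>; at a point of \<open>X \<inter> U\<close> where it did not, \<open>h\<close> could
be added to the local equations. Given a point \<open>x\<close> of \<open>U\<close> with \<open>f s x = 0\<close> for all \<open>s \<in> S\<close>, the
segment from \<open>q\<close> to \<open>x\<close> in the chart runs in these directions only. Extended to complex times, it
gives a holomorphic curve along which \<open>h\<close> vanishes to infinite order at \<open>q\<close>, whence \<open>h x = 0\<close>.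
So in the chart \<open>X\<close> is exactly the slice where the coordinates in \<open>S\<close> are zero.\<close>

lemma algebraic_set_has_smooth_point:
  fixes X :: "(complex ^ 'n ^ 'n) set"
  assumes X: "algebraic_set X" and W: "open W" "X \<inter> W \<noteq> {}"
  obtains q U V \<phi> \<psi> I where "q \<in> X" "q \<in> U" "open U" "U \<subseteq> W" "open V" "homeomorphism U V \<phi> \<psi>"
    "matrix_holomorphic_on \<phi> U" "matrix_holomorphic_on \<psi> V" "\<phi> ` (U \<inter> X) = V \<inter> coordinate_subspace I"
proof -
  obtain q0 where q0: "q0 \<in> X \<inter> W" using W by blast
  have "partial_jacobian {} f q0 = mat 1" for f
    by (simp add: partial_jacobian_def mat_def vec_eq_iff)
  then have start: "local_equations X W {} f W q0" for f
    using W q0 by (simp add: local_equations_def)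
  have "\<exists>S. (\<exists>f U q. local_equations X W S f U q) \<and>
      (\<forall>S'. (\<exists>f U q. local_equations X W S' f U q) \<longrightarrow> card S' \<le> card S)"
    by (rule ex_has_greatest_nat[where k = "{}" and b = "Suc (card (UNIV :: ('n \<times> 'n) set))"])
      (use start in \<open>auto simp del: card_prod intro!: le_imp_less_Suc card_mono\<close>)
  then obtain S f W0 q where loc: "local_equations X W S f W0 q"
    and max: "\<And>S' f U q. local_equations X W S' f U q \<Longrightarrow> card S' \<le> card S" by blast
  let ?\<Phi> = "partial_coords S f" and ?J = "partial_jacobian S f"
  have f: "\<And>s. s \<in> S \<Longrightarrow> matrix_polynomial (f s)"
    and f0: "\<And>s A. s \<in> S \<Longrightarrow> A \<in> X \<Longrightarrow> A \<in> W0 \<Longrightarrow> f s A = 0"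
    and W0: "open W0" "W0 \<subseteq> W" "q \<in> X" "q \<in> W0" "det (?J q) \<noteq> 0"
    using loc by (auto simp: local_equations_def)
  obtain U e \<psi> where U: "open U" "q \<in> U" "U \<subseteq> W0" "e > 0"
    and homeo: "homeomorphism U (ball (?\<Phi> q) e) ?\<Phi> \<psi>"
    and J: "\<And>x. x \<in> U \<Longrightarrow> det (?J x) \<noteq> 0"
    and der\<psi>: "\<And>y K. y \<in> ball (?\<Phi> q) e \<Longrightarrow> ?J (\<psi> y) ** K = mat 1 \<Longrightarrow> (\<psi> has_derivative matrix_endo K) (at y)"
    using holomorphic_inverse_function[OF f W0(5,1,4)] by blast
  define V where "V = ball (?\<Phi> q) e"
  have inU: "\<psi> y \<in> U" "?\<Phi> (\<psi> y) = y" if "y \<in> V" for y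
    using homeomorphism_image2[OF homeo] homeomorphism_apply2[OF homeo] that by (auto simp: V_def)
  have \<Phi>V: "?\<Phi> x \<in> V" "\<psi> (?\<Phi> x) = x" if "x \<in> U" for x
    using homeomorphism_image1[OF homeo] homeomorphism_apply1[OF homeo] that by (auto simp: V_def)
  have invJ: "\<exists>K. ?J x ** K = mat 1 \<and> K ** ?J x = mat 1" if "x \<in> U" for x
    using J[OF that] by (auto simp flip: invertible_det_nz simp: invertible_def)
  define H where "H = {h. matrix_polynomial h \<and> (\<forall>A\<in>X \<inter> U. h A = 0)}"
  define D where "D s h x = det (\<chi> s' t. if s' = s then partial_deriv t h x else ?J x $ s' $ t)" for s h x
  have DH: "D s h \<in> H" if h: "h \<in> H" and s: "s \<notin> S" for s h
  proof -
    have polyh: "matrix_polynomial h" using h by (simp add: H_def)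
    have "matrix_polynomial (D s h)"
      unfolding D_def
    proof (intro matrix_polynomial_det)
      fix i j
      show "matrix_polynomial (\<lambda>A. (\<chi> s' t. if s' = s then partial_deriv t h A else ?J A $ s' $ t) $ i $ j)"
        using partial_deriv(1)[OF polyh] matrix_polynomial_partial_jacobian[of S f, OF f] by (cases "i = s") simp_all
    qed
    moreover have "D s h A = 0" if A: "A \<in> X \<inter> U" for A
    proof (rule ccontr)
      assume nz: "D s h A \<noteq> 0"
      have "partial_jacobian (insert s S) (f(s := h)) A = (\<chi> s' t. if s' = s then partial_deriv t h A else ?J A $ s' $ t)"
        using s by (auto simp: partial_jacobian_def vec_eq_iff)
      then have "local_equations X W (insert s S) (f(s := h)) U A"
        using nz A f f0 polyh h U W0(2) by (auto simp: local_equations_def D_def H_def)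
      from max[OF this] show False using s by (simp add: finite_subset[OF subset_UNIV])
    qed
    ultimately show ?thesis by (simp add: H_def)
  qed
  have zeros: "h x = 0" if h: "h \<in> H" and x: "x \<in> U" "\<And>s. s \<in> S \<Longrightarrow> f s x = 0" for h x
  proof -
    define v where "v = ?\<Phi> x - ?\<Phi> q"
    have vS: "entry_at s v = 0" if "s \<in> S" for s
      using x(2)[OF that] f0[OF that W0(3,4)] that by (simp add: v_def partial_coords_def)
    \<comment> \<open>\<open>\<gamma>\<close> runs from \<open>q\<close> at time \<open>0\<close> to \<open>x\<close> at time \<open>1\<close>; \<open>d h\<close> is its velocity applied to \<open>h\<close>, up to the
      factor \<open>det (?J (\<gamma> t))\<close>.\<close>
    define T where "T = {t. ?\<Phi> q + cscale t v \<in> V}"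
    define \<gamma> where "\<gamma> t = \<psi> (?\<Phi> q + cscale t v)" for t
    define d where "d h x = (\<Sum>s\<in>- S. entry_at s v * D s h x)" for h x
    have contline: "continuous_on UNIV (\<lambda>t. ?\<Phi> q + cscale t v)"
      unfolding cscale_def by (intro continuous_intros)
    have "open T"
      using open_vimage[OF _ contline, of V] by (simp add: T_def V_def vimage_def)
    moreover have "convex T"
      unfolding convex_alt
    proof (intro ballI allI impI)
      fix s t and a :: real assume st: "s \<in> T" "t \<in> T" "0 \<le> a \<and> a \<le> 1"
      have "?\<Phi> q + cscale ((1 - a) *\<^sub>R s + a *\<^sub>R t) v
          = (1 - a) *\<^sub>R (?\<Phi> q + cscale s v) + a *\<^sub>R (?\<Phi> q + cscale t v)"
        by (simp add: cscale_def vec_eq_iff algebra_simps)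
      also have "\<dots> \<in> V"
        using st convex_ball[of "?\<Phi> q" e] unfolding T_def V_def convex_alt by blast
      finally show "(1 - a) *\<^sub>R s + a *\<^sub>R t \<in> T" by (simp add: T_def)
    qed
    moreover have "0 \<in> T" using U(4) by (simp add: T_def V_def)
    moreover have "1 \<in> T" using \<Phi>V(1)[OF x(1)] by (simp add: T_def v_def)
    moreover have T: "\<gamma> t \<in> U" if "t \<in> T" for t using that inU by (simp add: T_def \<gamma>_def)
    have der: "((\<lambda>t. h (\<gamma> t)) has_field_derivative d h (\<gamma> t) * (1 / det (?J (\<gamma> t)))) (at t)"
      if h: "matrix_polynomial h" and t: "t \<in> T" for h t
    proof -
      obtain K where K: "?J (\<gamma> t) ** K = mat 1" "K ** ?J (\<gamma> t) = mat 1" using invJ[OF T[OF t]] by blast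
      have "(\<psi> has_derivative matrix_endo K) (at (?\<Phi> q + cscale t v))"
        using der\<psi>[of "?\<Phi> q + cscale t v" K] t K by (simp add: T_def V_def \<gamma>_def)
      from deriv_along_chart_line[OF h this K(2)[unfolded \<gamma>_def]]
      have "((\<lambda>t. h (\<gamma> t)) has_field_derivative (\<Sum>s\<in>UNIV. entry_at s v * D s h (\<gamma> t)) / det (?J (\<gamma> t))) (at t)"
        by (simp only: D_def \<gamma>_def)
      also have "(\<Sum>s\<in>UNIV. entry_at s v * D s h (\<gamma> t)) = d h (\<gamma> t)"
        unfolding d_def by (rule sum.mono_neutral_right) (auto simp: vS)
      finally show ?thesis by simp
    qed
    have hol: "(\<lambda>t. h (\<gamma> t)) holomorphic_on T" if "matrix_polynomial h" for h
      using der[OF that] by (intro holomorphic_onI) (meson field_differentiable_at_within field_differentiable_def)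
    have dH: "d h \<in> H" if "h \<in> H" for h
      unfolding d_def H_def
      using DH[OF that] by (auto simp: H_def intro!: matrix_polynomial_sum matrix_polynomial.mult matrix_polynomial.const)
    have "(\<lambda>t. 1 / det (?J (\<gamma> t))) holomorphic_on T"
      using J T by (intro holomorphic_intros hol matrix_polynomial_det matrix_polynomial_partial_jacobian f) auto
    moreover have "\<gamma> 0 = q" using \<Phi>V(2)[OF U(2)] by (simp add: \<gamma>_def)
    moreover have "\<gamma> 1 = x" using \<Phi>V(2)[OF x(1)] by (simp add: \<gamma>_def v_def)
    ultimately have "h (\<gamma> 1) = 0"
      using analytic_vanishing_by_recursion[of T 0 1 H "\<lambda>h t. h (\<gamma> t)" "\<lambda>t. 1 / det (?J (\<gamma> t))" d h]
        convex_connected dH der hol h W0(3) U(2) by (auto simp: H_def DERIV_imp_deriv)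
    then show ?thesis using \<open>\<gamma> 1 = x\<close> by simp
  qed
  obtain P where P: "\<forall>p\<in>P. matrix_polynomial p" "X = {A. \<forall>p\<in>P. p A = 0}"
    using X unfolding algebraic_set_def by blast
  have XU: "x \<in> X \<longleftrightarrow> (\<forall>s\<in>S. f s x = 0)" if "x \<in> U" for x
  proof
    show "\<forall>s\<in>S. f s x = 0" if "x \<in> X" using f0 that \<open>x \<in> U\<close> U(3) by blast
    assume "\<forall>s\<in>S. f s x = 0"
    moreover have "p \<in> H" if "p \<in> P" for p using P that by (auto simp: H_def)
    ultimately show "x \<in> X" using zeros[OF _ \<open>x \<in> U\<close>] P by blast
  qed
  have coords: "?\<Phi> x \<in> coordinate_subspace (- S) \<longleftrightarrow> (\<forall>s\<in>S. f s x = 0)" for x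
    by (auto simp: coordinate_subspace_def partial_coords_def)
  have "?\<Phi> ` (U \<inter> X) = V \<inter> coordinate_subspace (- S)"
  proof (intro equalityI subsetI)
    fix y assume "y \<in> ?\<Phi> ` (U \<inter> X)"
    then show "y \<in> V \<inter> coordinate_subspace (- S)" using \<Phi>V(1) XU coords by auto
  next
    fix y assume y: "y \<in> V \<inter> coordinate_subspace (- S)"
    then have "\<psi> y \<in> U \<inter> X" using inU[of y] XU[of "\<psi> y"] coords[of "\<psi> y"] by auto
    then show "y \<in> ?\<Phi> ` (U \<inter> X)" using inU(2)[of y] y by (metis IntD1 imageI)
  qed
  moreover have "matrix_holomorphic_on \<psi> V"
    unfolding matrix_holomorphic_on_def
  proof
    fix y assume y: "y \<in> V"
    then obtain K where "?J (\<psi> y) ** K = mat 1" using invJ inU by blast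
    then have "(\<psi> has_derivative matrix_endo K) (at y)" using der\<psi> y by (simp add: V_def)
    then show "\<exists>f'. (\<psi> has_derivative f') (at y) \<and> (\<forall>c h. f' (cscale c h) = cscale c (f' h))"
      by (intro exI[of _ "matrix_endo K"]) (simp add: matrix_endo_cscale)
  qed
  moreover have "matrix_holomorphic_on ?\<Phi> U" by (rule matrix_holomorphic_on_partial_coords) (rule f)
  moreover have "open V" by (simp add: V_def)
  moreover have "U \<subseteq> W" using U(3) W0(2) by blast
  ultimately show thesis
    using that[OF W0(3) U(2,1) _ _ homeo[folded V_def]] by blast
qed

section \<open>Transport of charts by the unit group\<close>

lemma bounded_linear_two_sided_mult:
  fixes g h :: "complex ^ 'n ^ 'n"
  shows "bounded_linear (\<lambda>x :: complex ^ 'n ^ 'n. g ** x ** h)"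
proof (rule linear_conv_bounded_linear[THEN iffD1], rule linearI)
  show "g ** (x + y) ** h = g ** x ** h + g ** y ** h" for x y
    by (simp add: matrix_add_ldistrib matrix_mult_distrib)
  have "r *\<^sub>R x = cscale (complex_of_real r) x" for r and x :: "complex ^ 'n ^ 'n"
    unfolding vec_eq_iff cscale_def vector_scaleR_component vec_lambda_beta
    by (intro allI) (rule scaleR_conv_of_real)
  then show "g ** (r *\<^sub>R x) ** h = r *\<^sub>R (g ** x ** h)" for r and x :: "complex ^ 'n ^ 'n"
    by (simp flip: cscale_mult)
qed

lemma matrix_holomorphic_two_sided_mult:
  fixes g h :: "complex ^ 'n ^ 'n"
  shows "matrix_holomorphic_on (\<lambda>x. g ** x ** h) U"
  unfolding matrix_holomorphic_on_def
proof
  fix x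
  show "\<exists>f'. ((\<lambda>x. g ** x ** h) has_derivative f') (at x) \<and> (\<forall>c h. f' (cscale c h) = cscale c (f' h))"
    by (intro exI[of _ "\<lambda>x. g ** x ** h"] conjI bounded_linear_imp_has_derivative bounded_linear_two_sided_mult)
      (simp flip: cscale_mult)
qed

lemma matrix_holomorphic_on_compose:
  assumes f: "matrix_holomorphic_on f U" and g: "matrix_holomorphic_on g V" and "f ` U \<subseteq> V"
  shows "matrix_holomorphic_on (g \<circ> f) U"
  unfolding matrix_holomorphic_on_def
proof
  fix x assume x: "x \<in> U"
  obtain f' where f': "(f has_derivative f') (at x)" "\<And>c h. f' (cscale c h) = cscale c (f' h)"
    using f x unfolding matrix_holomorphic_on_def by blast
  have "f x \<in> V" using assms x by blast
  then obtain g' where g': "(g has_derivative g') (at (f x))" "\<And>c h. g' (cscale c h) = cscale c (g' h)"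
    using g unfolding matrix_holomorphic_on_def by blast
  have "(g \<circ> f has_derivative (\<lambda>h. g' (f' h))) (at x)"
    using has_derivative_compose[OF f'(1) g'(1)] by (simp add: o_def)
  then show "\<exists>h'. (g \<circ> f has_derivative h') (at x) \<and> (\<forall>c h. h' (cscale c h) = cscale c (h' h))"
    using f'(2) g'(2) by (intro exI[of _ "\<lambda>h. g' (f' h)"]) simp
qed

theorem proposition3p6:
  fixes M :: "(complex ^ 'n ^ 'n) set" and a :: "complex ^ 'n ^ 'n"
  assumes "algebraic_submonoid M"
    and "irreducible_set M"
    and "regular_monoid M"
    and "a \<in> M"
  shows "complex_submanifold (D_class M a)"
proof -
  note M = assms(1,2)
  define D where "D = D_class M a"
  have orbit: "D = {g ** a ** h |g h. g \<in> unit_group M \<and> h \<in> unit_group M}"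
    unfolding D_def by (rule D_class_eq_double_orbit[OF M assms(4)])
  have one: "mat 1 \<in> unit_group M"
    using M by (simp add: unit_group_def algebraic_submonoid_def matrix_submonoid_def)
  have "mat 1 ** a ** mat 1 \<in> D" unfolding orbit using one by blast
  then have aD: "a \<in> D" by simp
  have invariant: "g ** x ** h \<in> D" if "x \<in> D" "g \<in> unit_group M" "h \<in> unit_group M" for x g h
  proof -
    obtain g1 h1 where "g1 \<in> unit_group M" "h1 \<in> unit_group M" "x = g1 ** a ** h1"
      using \<open>x \<in> D\<close> unfolding orbit by blast
    then have "g ** x ** h = (g ** g1) ** a ** (h1 ** h)" by (simp add: matrix_mul_assoc)
    then show ?thesis unfolding orbit using that \<open>g1 \<in> _\<close> \<open>h1 \<in> _\<close> unit_group_mult[OF M(1)] by blast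
  qed
  have transitive: "\<exists>g h. g \<in> unit_group M \<and> h \<in> unit_group M \<and> y = g ** x ** h" if "x \<in> D" "y \<in> D" for x y
  proof -
    obtain g1 h1 where 1: "g1 \<in> unit_group M" "h1 \<in> unit_group M" "x = g1 ** a ** h1"
      using \<open>x \<in> D\<close> unfolding orbit by blast
    obtain g2 h2 where 2: "g2 \<in> unit_group M" "h2 \<in> unit_group M" "y = g2 ** a ** h2"
      using \<open>y \<in> D\<close> unfolding orbit by blast
    obtain g3 where 3: "g3 \<in> unit_group M" "g3 ** g1 = mat 1" using unit_group_inverse[OF M(1) 1(1)] by blast
    obtain h3 where 4: "h3 \<in> unit_group M" "h1 ** h3 = mat 1" using unit_group_inverse[OF M(1) 1(2)] by blast
    have "(g2 ** g3) ** x ** (h3 ** h2) = g2 ** (g3 ** g1) ** a ** (h1 ** h3) ** h2"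
      unfolding 1(3) by (simp only: matrix_mul_assoc)
    also have "\<dots> = y" by (simp add: 2 3 4)
    finally show ?thesis using unit_group_mult[OF M(1)] 2 3 4 by metis
  qed
  obtain W X where W: "open W" "a \<in> W" "algebraic_set X" "D \<inter> W = X \<inter> W"
    using D_class_locally_algebraic[OF M assms(3,4)] unfolding D_def by blast
  have "X \<inter> W \<noteq> {}" using W aD by blast
  then obtain q U V \<phi> \<psi> I where q: "q \<in> X" "q \<in> U" and U: "open U" "U \<subseteq> W" "open V"
    and homeo: "homeomorphism U V \<phi> \<psi>" and hol: "matrix_holomorphic_on \<phi> U" "matrix_holomorphic_on \<psi> V"
    and slice: "\<phi> ` (U \<inter> X) = V \<inter> coordinate_subspace I"
    by (rule algebraic_set_has_smooth_point[OF W(3,1)])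
  have UX: "U \<inter> X = U \<inter> D" using W(4) U(2) by blast
  then have qD: "q \<in> D" using q by blast
  have "complex_submanifold_dim (card I) D"
    unfolding complex_submanifold_dim_def
  proof
    fix p assume "p \<in> D"
    then obtain g h where gh: "g \<in> unit_group M" "h \<in> unit_group M" "p = g ** q ** h" using transitive[OF qD] by blast
    obtain g' where g': "g' \<in> unit_group M" "g ** g' = mat 1" "g' ** g = mat 1" using unit_group_inverse[OF M(1) gh(1)] .
    obtain h' where h': "h' \<in> unit_group M" "h ** h' = mat 1" "h' ** h = mat 1" using unit_group_inverse[OF M(1) gh(2)] .
    define \<sigma> where "\<sigma> x = g ** x ** h" for x
    define \<tau> where "\<tau> x = g' ** x ** h'" for x
    have \<sigma>\<tau>: "\<sigma> (\<tau> x) = x" for x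
    proof -
      have "\<sigma> (\<tau> x) = (g ** g') ** x ** (h' ** h)" unfolding \<sigma>_def \<tau>_def by (simp only: matrix_mul_assoc)
      then show ?thesis by (simp add: g' h')
    qed
    have \<tau>\<sigma>: "\<tau> (\<sigma> x) = x" for x
    proof -
      have "\<tau> (\<sigma> x) = (g' ** g) ** x ** (h ** h')" unfolding \<sigma>_def \<tau>_def by (simp only: matrix_mul_assoc)
      then show ?thesis by (simp add: g' h')
    qed
    have cont: "continuous_on S \<sigma>" "continuous_on S \<tau>" for S
      unfolding \<sigma>_def \<tau>_def by (intro linear_continuous_on bounded_linear_two_sided_mult)+
    have image: "\<sigma> ` U = \<tau> -` U" "\<sigma> ` D = D"
    proof -
      show "\<sigma> ` U = \<tau> -` U" using \<sigma>\<tau> \<tau>\<sigma> by (auto simp: image_iff) metis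
      have "\<sigma> x \<in> D" "\<tau> x \<in> D" if "x \<in> D" for x
        using invariant that gh g' h' by (simp_all add: \<sigma>_def \<tau>_def)
      then show "\<sigma> ` D = D" using \<sigma>\<tau> by (auto simp: image_iff) metis
    qed
    have homeo_\<sigma>: "homeomorphism (\<sigma> ` U) U \<tau> \<sigma>"
      by (rule homeomorphismI) (use cont \<sigma>\<tau> \<tau>\<sigma> in auto)
    have "open (\<sigma> ` U)" unfolding image by (rule open_vimage[OF U(1) cont(2)])
    moreover have "p \<in> \<sigma> ` U" using gh(3) q by (auto simp: \<sigma>_def)
    moreover have "homeomorphism (\<sigma> ` U) V (\<phi> \<circ> \<tau>) (\<sigma> \<circ> \<psi>)"
      by (rule homeomorphism_compose[OF homeo_\<sigma> homeo])
    moreover have "matrix_holomorphic_on \<tau> S" "matrix_holomorphic_on \<sigma> S" for S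
      unfolding \<sigma>_def \<tau>_def by (rule matrix_holomorphic_two_sided_mult)+
    then have "matrix_holomorphic_on (\<phi> \<circ> \<tau>) (\<sigma> ` U)" "matrix_holomorphic_on (\<sigma> \<circ> \<psi>) V"
      using matrix_holomorphic_on_compose[of \<tau> "\<sigma> ` U" \<phi> U] matrix_holomorphic_on_compose[of \<psi> V \<sigma> UNIV] hol
      by (auto simp: \<tau>\<sigma> image_image)
    moreover have "(\<phi> \<circ> \<tau>) ` (\<sigma> ` U \<inter> D) = V \<inter> coordinate_subspace I"
    proof -
      have "\<sigma> ` U \<inter> D = \<sigma> ` (U \<inter> D)" using image(2) \<tau>\<sigma> by (metis image_Int inj_on_inverseI)
      then have "(\<phi> \<circ> \<tau>) ` (\<sigma> ` U \<inter> D) = \<phi> ` (U \<inter> D)" by (simp add: image_image \<tau>\<sigma>)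
      then show ?thesis using slice UX by simp
    qed
    ultimately show "\<exists>U V \<phi> \<psi> J. open U \<and> p \<in> U \<and> open V \<and> homeomorphism U V \<phi> \<psi> \<and>
        matrix_holomorphic_on \<phi> U \<and> matrix_holomorphic_on \<psi> V \<and>
        card J = card I \<and> \<phi> ` (U \<inter> D) = V \<inter> coordinate_subspace J"
      using U(3) by blast
  qed
  then show ?thesis unfolding complex_submanifold_def D_def by blast
qed

end
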